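(* Let $ABC$ be a triangle in the hyperbolic plane. Let $M_a, M_b, M_c$ be the points on the sides $BC$, $CA$, $AB$ respectively such that each of the segments $AM_a$, $BM_b$, $CM_c$ divides triangle $ABC$ into two triangles of equal hyperbolic area, and assume that $M_a, M_b, M_c$ lie on a hyperbolic circle $\Omega$. Let $H_a, H_b, H_c$ be the feet, on the lines $BC$, $CA$, $AB$ respectively, of the pseudoaltitudes of triangle $ABC$. Then $\Omega$ passes through $H_a, H_b, H_c$; more precisely, $H_a$ is the second point of intersection (besides $M_a$) of $\Omega$ with line $BC$, $H_b$ is the second point of intersection (besides $M_b$) of $\Omega$ with line $CA$, and $H_c$ is the second point of intersection (besides $M_c$) of $\Omega$ with line $AB$.
   Context: Intersections are counted with multiplicity: if $\Omega$ is tangent to a side line at $M_a$ (resp. $M_b$, $M_c$), the second point of intersection is that point itself. Signed angle quantity: for a non-degenerate triangle $XYZ$ put $\sphericalangle XYZ = \angle XYZ-\angle ZXY-\angle YZX$, where the angles are signed: $\angle XYZ>0$ if and only if the rotation around $Y$ along the shortest arc from the ray $YX$ to the ray $YZ$ is counterclockwise. (All three signed angles of one triangle have the same sign, so $\sphericalangle XYZ$ is $\pm$ the same expression in unsigned angles.) Feet of pseudoaltitudes: label the triangle so that $A,B,C$ are in clockwise order. The foot $H_a$ of the pseudoaltitude from $A$ is the unique point $X$ of the line $BC$ with $\sphericalangle BXA=\sphericalangle AXC$, where the expressions are extended by continuity when $X$ is $B$ or $C$ (so $\sphericalangle BXA=\pi-2\angle ABC$ at $X=B$ and $\sphericalangle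 AXC=\pi-2\angle ACB$ at $X=C$, with unsigned angles on the right). Similarly $H_b$ on line $CA$ is defined by $\sphericalangle CH_bB=\sphericalangle BH_bA$, and $H_c$ on line $AB$ by $\sphericalangle AH_cC=\sphericalangle CH_cB$. *)

theory Defs
  imports "HOL-Analysis.Analysis"
begin

text \<open>
  The hyperbolic plane (curvature \<open>-1\<close>) in the Beltrami--Klein model: the points form the open
  unit disc, geodesics are Euclidean chords, and triangles are Euclidean convex hulls.
\<close>

definition hplane :: "(real^2) set" where
  "hplane = ball 0 1"

definition hdist :: "real^2 \<Rightarrow> real^2 \<Rightarrow> real" where
  "hdist p q = arcosh ((1 - p \<bullet> q) / sqrt ((1 - p \<bullet> p) * (1 - q \<bullet> q)))"

definition hcircle :: "real^2 \<Rightarrow> real \<Rightarrow> (real^2) set" where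
  "hcircle P r = {X \<in> hplane. hdist P X = r}"

definition is_hcircle :: "(real^2) set \<Rightarrow> bool" where
  "is_hcircle \<Omega> \<longleftrightarrow> (\<exists>P r. P \<in> hplane \<and> r > 0 \<and> \<Omega> = hcircle P r)"

definition hline :: "real^2 \<Rightarrow> real^2 \<Rightarrow> (real^2) set" where
  "hline P Q = affine hull {P, Q} \<inter> hplane"

definition hsegment :: "real^2 \<Rightarrow> real^2 \<Rightarrow> (real^2) set" where
  "hsegment P Q = closed_segment P Q"

definition htriangle :: "real^2 \<Rightarrow> real^2 \<Rightarrow> real^2 \<Rightarrow> (real^2) set" where
  "htriangle P Q R = convex hull {P, Q, R}"

text \<open>The Riemannian metric of the model at \<open>p\<close>; angles and area below are taken with respect to it.\<close>

definition hmetric :: "real^2 \<Rightarrow> real^2 \<Rightarrow> real^2 \<Rightarrow> real" where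
  "hmetric p u v = (u \<bullet> v) / (1 - p \<bullet> p) + (p \<bullet> u) * (p \<bullet> v) / (1 - p \<bullet> p)\<^sup>2"

definition harea_density :: "real^2 \<Rightarrow> real" where
  "harea_density p =
     sqrt (hmetric p (axis 1 1) (axis 1 1) * hmetric p (axis 2 1) (axis 2 1)
           - (hmetric p (axis 1 1) (axis 2 1))\<^sup>2)"

lemma harea_density_eq:
  assumes "p \<in> hplane"
  shows "harea_density p = 1 / sqrt ((1 - p \<bullet> p) ^ 3)"
proof -
  define s where "s = 1 - p \<bullet> p"
  have pp: "p \<bullet> p = (p $ 1)\<^sup>2 + (p $ 2)\<^sup>2"
    by (simp add: inner_vec_def UNIV_2 power2_eq_square)
  have "norm p < 1"
    using assms by (simp add: hplane_def)
  then have "s > 0"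
    by (simp add: s_def dot_square_norm power_less_one_iff)
  have e: "axis 1 1 \<bullet> (axis 1 1 :: real^2) = 1" "axis 2 1 \<bullet> (axis 2 1 :: real^2) = 1"
      "axis 1 1 \<bullet> (axis 2 1 :: real^2) = 0"
    by (simp_all add: inner_axis_axis)
  have q: "p \<bullet> axis 1 1 = p $ 1" "p \<bullet> axis 2 1 = p $ 2"
    by (simp_all add: inner_axis)
  have "hmetric p (axis 1 1) (axis 1 1) * hmetric p (axis 2 1) (axis 2 1)
           - (hmetric p (axis 1 1) (axis 2 1))\<^sup>2
        = (s + (p $ 1)\<^sup>2 + (p $ 2)\<^sup>2) / s ^ 3"
    using \<open>s > 0\<close> unfolding hmetric_def e q s_def[symmetric]
    by (simp add: field_simps power2_eq_square power3_eq_cube)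
  also have "\<dots> = 1 / s ^ 3"
    using pp by (simp add: s_def)
  finally show ?thesis
    by (simp add: harea_density_def s_def real_sqrt_divide)
qed

definition harea :: "(real^2) set \<Rightarrow> real" where
  "harea S = (LINT p:S|lborel. harea_density p)"

definition hangle :: "real^2 \<Rightarrow> real^2 \<Rightarrow> real^2 \<Rightarrow> real" where
  "hangle X Y Z =
     arccos (hmetric Y (X - Y) (Z - Y) /
             sqrt (hmetric Y (X - Y) (X - Y) * hmetric Y (Z - Y) (Z - Y)))"

text \<open>Positive if and only if \<open>P\<close>, \<open>Q\<close>, \<open>R\<close> are in counterclockwise order.\<close>

definition orient :: "real^2 \<Rightarrow> real^2 \<Rightarrow> real^2 \<Rightarrow> real" where
  "orient P Q R = (Q - P) $ 1 * (R - P) $ 2 - (Q - P) $ 2 * (R - P) $ 1"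

definition signed_hangle :: "real^2 \<Rightarrow> real^2 \<Rightarrow> real^2 \<Rightarrow> real" where
  "signed_hangle X Y Z = (if orient Y X Z < 0 then - hangle X Y Z else hangle X Y Z)"

definition pseudoangle :: "real^2 \<Rightarrow> real^2 \<Rightarrow> real^2 \<Rightarrow> real" where
  "pseudoangle X Y Z = signed_hangle X Y Z - signed_hangle Z X Y - signed_hangle Y Z X"

text \<open>
  The condition characterising the foot \<open>X\<close> of the pseudoaltitude from \<open>A\<close> when \<open>A\<close>, \<open>B\<close>, \<open>C\<close> are
  in clockwise order. At \<open>X = B\<close> and \<open>X = C\<close> the degenerate side is replaced by its limit along
  the line \<open>BC\<close>.
\<close>

definition pseudofoot_cond :: "real^2 \<Rightarrow> real^2 \<Rightarrow> real^2 \<Rightarrow> real^2 \<Rightarrow> bool" where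
  "pseudofoot_cond A B C X \<longleftrightarrow>
     X \<in> hline B C \<and>
     (if X = B then pi - 2 * hangle A B C else pseudoangle B X A) =
     (if X = C then pi - 2 * hangle A C B else pseudoangle A X C)"

text \<open>If \<open>A\<close>, \<open>B\<close>, \<open>C\<close> are not in clockwise order, then \<open>A\<close>, \<open>C\<close>, \<open>B\<close> are.\<close>

definition pseudofoot :: "real^2 \<Rightarrow> real^2 \<Rightarrow> real^2 \<Rightarrow> real^2" where
  "pseudofoot A B C =
     (if orient A B C < 0 then THE X. pseudofoot_cond A B C X
      else THE X. pseudofoot_cond A C B X)"

text \<open>A circle is tangent to a line at \<open>M\<close> if and only if \<open>M\<close> is their only common point.\<close>

definition second_intersection :: "(real^2) set \<Rightarrow> (real^2) set \<Rightarrow> real^2 \<Rightarrow> real^2 \<Rightarrow> bool" where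
  "second_intersection \<Omega> l M X \<longleftrightarrow>
     (if \<Omega> \<inter> l = {M} then X = M else X \<noteq> M \<and> \<Omega> \<inter> l = {M, X})"

end

(*
  On the hyperboloid a hyperbolic circle is the section by an affine plane, i.e. a level set of a linear
  functional. Put u, v, w > 0 with 2uv = 1 + cosh AB, 2vw = 1 + cosh BC, 2wu = 1 + cosh CA. The area
  formula tan(S/2) = D / (1 + cosh a + cosh b + cosh c) shows that the point bisecting the area on BC, written
  as b B + g C on the hyperboloid, satisfies b v + g w = 1 and b (v + 1) = g (w + 1). Hence the functional
  with values u, v, w at A, B, C equals 1 at all three bisecting points, and the circle, if there is one, is
  its level set. On BC the difference of the squared functional and the norm form factors as
  (b (v - 1) - g (w - 1)) (b (v + 1) - g (w + 1)), so the second intersection is given by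
  b (v - 1) = g (w - 1). This is also the condition for the pseudoaltitude foot, because
  tan((Y - X - Z)/2) = (1 + cosh XZ - cosh XY - cosh YZ) / D for the angles of a triangle XYZ.
*)
theory Submission
  imports Defs
begin

text \<open>\<open>harea\<close> is a Lebesgue integral in the Klein model, so the area formula has
  to be computed: in polar coordinates about a vertex, with both antiderivatives given explicitly.
  On a side, the determinants of the two parts of the triangle are g D and b D, so D drops out of
  the area condition and of the foot condition. Both then compare g (1 + cosh CA) with b (1 + cosh
  AB), each multiplied by one of 1 + g - b and 1 + b - g; the ratio (1 + cosh CA) : (1 + cosh AB) is
  w : v, whence the weights. Solving means passing to squares, and the care lies in the choice of
  root: b and g are positive at a bisecting point, but a foot may lie outside the segment and give
  them opposite signs. That a given circle is the level set of this very functional is a sign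
  argument around the three sides. A foot is a definite description, so its existence inside the
  disc has to be shown too.\<close>

section \<open>The Lorentz form in homogeneous coordinates\<close>

text \<open>This is the Lorentz product of (1, p) and (1, q), with the sign that makes it positive
  on the disc.\<close>

definition lorentz :: "real^2 \<Rightarrow> real^2 \<Rightarrow> real" where
  "lorentz p q = 1 - p \<bullet> q"

lemma inner_real2: "p \<bullet> q = p $ 1 * q $ 1 + p $ 2 * q $ 2" for p q :: "real^2"
  by (simp add: inner_vec_def UNIV_2)

lemma lorentz_coords: "lorentz p q = 1 - p $ 1 * q $ 1 - p $ 2 * q $ 2"
  by (simp add: lorentz_def inner_real2)

lemma lorentz_commute: "lorentz p q = lorentz q p"
  by (simp add: lorentz_def inner_commute)

lemma lorentz_affine: "lorentz p (q + t *\<^sub>R (r - q)) = (1 - t) * lorentz p q + t * lorentz p r"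
  by (simp add: lorentz_def inner_add_right inner_diff_right algebra_simps)

lemma hplane_iff: "p \<in> hplane \<longleftrightarrow> lorentz p p > 0"
  by (simp add: hplane_def lorentz_def dot_square_norm power_less_one_iff)

lemma lorentz_pos:
  assumes "p \<in> hplane" "q \<in> hplane"
  shows "lorentz p q > 0"
proof -
  have "p \<bullet> q \<le> norm p * norm q" by (rule norm_cauchy_schwarz)
  also have "\<dots> < 1"
    using assms mult_strict_mono[of "norm p" 1 "norm q" 1] by (simp add: hplane_def)
  finally show ?thesis by (simp add: lorentz_def)
qed

lemma hplane_convex: "convex hplane"
  by (simp add: hplane_def)

text \<open>The difference of the two sides is \<open>hmetric p (q - p) (q - p)\<close> with its
  denominator cleared, a positive definite form in \<open>q - p\<close>.\<close>

lemma lorentz_reverse_Cauchy_Schwarz: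
  assumes "p \<in> hplane" "p \<noteq> q"
  shows "(lorentz p q)\<^sup>2 > lorentz p p * lorentz q q"
proof -
  define d where "d = (q $ 1 - p $ 1)\<^sup>2 + (q $ 2 - p $ 2)\<^sup>2"
  have "d > 0"
    using assms(2) by (auto simp: d_def vec_eq_iff forall_2 sum_power2_gt_zero_iff)
  moreover have "lorentz p p > 0" using assms(1) by (simp add: hplane_iff)
  moreover have "(lorentz p q)\<^sup>2 - lorentz p p * lorentz q q
      = lorentz p p * d + (p $ 1 * (q $ 1 - p $ 1) + p $ 2 * (q $ 2 - p $ 2))\<^sup>2"
    by (simp add: lorentz_coords d_def power2_eq_square algebra_simps)
  ultimately show ?thesis by (smt (verit) mult_pos_pos zero_le_power2)
qed

subsection \<open>The area of a hyperbolic triangle\<close>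

text \<open>The coordinate map \<open>g\<close> carries boxes of pairs to boxes of
  \<open>real^2\<close> with the same content, so Fubini for pairs transfers. The first coordinate
  is integrated innermost because it will be the radial one.\<close>

lemma integral_real2_iterated:
  fixes f :: "real^2 \<Rightarrow> real"
  assumes "continuous_on (cbox a b) f"
  shows "integral (cbox a b) f =
    integral {a $ 2..b $ 2} (\<lambda>t. integral {a $ 1..b $ 1} (\<lambda>s. f (vector [s, t])))"
proof -
  define g where "g = (\<lambda>x::real \<times> real. vector [fst x, snd x] :: real^2)"
  define h where "h = (\<lambda>x::real^2. (x $ 1, x $ 2))"
  have lin: "linear g"
    by (rule linearI) (simp_all add: g_def vec_eq_iff forall_2)
  have gcb: "g ` cbox u v = cbox (g u) (g v)" for u v
  proof -
    obtain u1 u2 v1 v2 where uv: "u = (u1, u2)" "v = (v1, v2)" by (metis surj_pair)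
    have "x \<in> g ` cbox u v" if "x \<in> cbox (g u) (g v)" for x
      using that by (intro image_eqI[of _ _ "(x $ 1, x $ 2)"])
        (auto simp: g_def mem_box_cart forall_2 vec_eq_iff cbox_Pair_eq uv)
    then show ?thesis
      by (auto simp: g_def mem_box_cart forall_2 cbox_Pair_eq uv)
  qed
  have hcb: "h ` cbox u v = cbox (h u) (h v)" for u v
  proof -
    have "x \<in> h ` cbox u v" if "x \<in> cbox (h u) (h v)" for x
      using that by (intro image_eqI[of _ _ "g x"])
        (auto simp: g_def h_def mem_box_cart forall_2 cbox_Pair_eq)
    then show ?thesis
      by (auto simp: h_def mem_box_cart forall_2 cbox_Pair_eq)
  qed
  have meas: "measure lborel (g ` cbox u v) = measure lborel (cbox u v)" for u v
  proof -
    obtain u1 u2 v1 v2 where uv: "u = (u1, u2)" "v = (v1, v2)" by (metis surj_pair)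
    have "cbox (g u) (g v) \<noteq> {} \<longleftrightarrow> u1 \<le> v1 \<and> u2 \<le> v2"
      by (simp add: interval_ne_empty_cart forall_2 uv g_def)
    then show ?thesis unfolding gcb
      by (auto simp add: content_cbox_if_cart uv g_def content_Pair UNIV_2 content_real_if)
  qed
  have "f integrable_on cbox a b"
    by (rule integrable_continuous[OF assms])
  then have "((\<lambda>x. f (g x)) has_integral (1 / 1) *\<^sub>R integral (cbox a b) f) (h ` cbox a b)"
  proof (intro has_integral_twiddle)
    show "\<And>x. continuous (at x) g"
      using lin by (simp add: linear_continuous_at linear_conv_bounded_linear)
    show "\<And>u v. \<exists>w z. g ` cbox u v = cbox w z" "\<And>u v. \<exists>w z. h ` cbox u v = cbox w z"
      using gcb hcb by blast+
    show "measure lborel (g ` cbox u v) = 1 * measure lborel (cbox u v)" for u v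
      by (simp add: meas)
  qed (auto simp: g_def h_def vec_eq_iff forall_2)
  then have 1: "integral (cbox a b) f = integral (cbox (h a) (h b)) (\<lambda>x. f (g x))"
    unfolding hcb by (simp add: integral_unique)
  have cont: "continuous_on (cbox (h a) (h b)) (\<lambda>x. f (g x))"
  proof (rule continuous_on_compose2[OF assms])
    show "continuous_on (cbox (h a) (h b)) g"
      using lin by (simp add: linear_continuous_on linear_conv_bounded_linear)
    have "g (h a) = a" "g (h b) = b" by (simp_all add: g_def h_def vec_eq_iff forall_2)
    then show "g ` cbox (h a) (h b) \<subseteq> cbox a b" by (simp add: gcb)
  qed
  have "integral (cbox (h a) (h b)) (\<lambda>x. f (g x))
      = integral {a $ 1..b $ 1} (\<lambda>s. integral {a $ 2..b $ 2} (\<lambda>t. f (vector [s, t])))"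
    using integral_prod_continuous[OF cont[unfolded h_def]] by (simp add: h_def g_def)
  also have "\<dots> = integral {a $ 2..b $ 2} (\<lambda>t. integral {a $ 1..b $ 1} (\<lambda>s. f (vector [s, t])))"
    using integral_swap_continuous[of "a $ 1" "a $ 2" "b $ 1" "b $ 2" "\<lambda>s t. f (vector [s, t])"]
      cont by (simp add: h_def g_def case_prod_unfold)
  finally show ?thesis using 1 by simp
qed

text \<open>The inner integral in polar coordinates about A, along the segment from A to Y; the
  factor \<open>s\<close> comes from the Jacobian.\<close>

lemma integral_radial_density:
  assumes A: "A \<in> hplane" and Y: "Y \<in> hplane" and ne: "A \<noteq> Y"
  shows "integral {0..1} (\<lambda>s. s * harea_density (A + s *\<^sub>R (Y - A))) =
    1 / (sqrt (lorentz Y Y) * (sqrt (lorentz A A) * sqrt (lorentz Y Y) + lorentz A Y))"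
proof -
  define \<alpha> \<beta> \<gamma> where "\<alpha> = lorentz A A" and "\<beta> = lorentz A Y - lorentz A A"
    and "\<gamma> = lorentz Y Y - 2 * lorentz A Y + lorentz A A"
  define Q where "Q = (\<lambda>s. \<alpha> + 2 * \<beta> * s + \<gamma> * s\<^sup>2)"
  define \<delta> where "\<delta> = \<beta>\<^sup>2 - \<alpha> * \<gamma>"
  have Q: "lorentz (A + s *\<^sub>R (Y - A)) (A + s *\<^sub>R (Y - A)) = Q s" for s
    by (simp add: Q_def \<alpha>_def \<beta>_def \<gamma>_def lorentz_coords power2_eq_square algebra_simps)
  have in_hp: "A + s *\<^sub>R (Y - A) \<in> hplane" if "s \<in> {0..1}" for s
  proof -
    have "(1 - s) *\<^sub>R A + s *\<^sub>R Y \<in> hplane"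
      using convexD[OF hplane_convex A Y] that by auto
    then show ?thesis by (simp add: algebra_simps)
  qed
  have Qpos: "Q s > 0" if "s \<in> {0..1}" for s
    using in_hp[OF that] by (simp add: hplane_iff Q)
  have \<delta>: "\<delta> = (lorentz A Y)\<^sup>2 - lorentz A A * lorentz Y Y"
    by (simp add: \<delta>_def \<alpha>_def \<beta>_def \<gamma>_def power2_eq_square algebra_simps)
  then have "\<delta> > 0" using lorentz_reverse_Cauchy_Schwarz[OF A ne] by simp
  have dens: "harea_density (A + s *\<^sub>R (Y - A)) = 1 / sqrt (Q s ^ 3)" if "s \<in> {0..1}" for s
    using harea_density_eq[OF in_hp[OF that]] Q[of s] by (simp add: lorentz_def)
  \<comment> \<open>The derivative of (\<alpha> + \<beta> s) / sqrt Q is (\<beta> Q - (\<alpha> +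
    \<beta> s) (\<beta> + \<gamma> s)) / Q^(3/2), whose numerator collapses to \<delta> s.\<close>
  define F where "F = (\<lambda>s. (\<alpha> + \<beta> * s) / (\<delta> * sqrt (Q s)))"
  have deriv: "(F has_vector_derivative s * harea_density (A + s *\<^sub>R (Y - A))) (at s within {0..1})"
    if s: "s \<in> {0..1}" for s
  proof -
    have sq: "sqrt (Q s) > 0" "sqrt (Q s) * sqrt (Q s) = Q s" using Qpos[OF s] by auto
    have q3: "sqrt (Q s ^ 3) = Q s * sqrt (Q s)"
      using Qpos[OF s] by (simp add: power3_eq_cube real_sqrt_mult)
    have "(F has_real_derivative
        (\<beta> * (\<delta> * sqrt (Q s)) - (\<alpha> + \<beta> * s) * (\<delta> * ((2 * \<beta> + 2 * \<gamma> * s) / (2 * sqrt (Q s)))))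
         / (\<delta> * sqrt (Q s))\<^sup>2) (at s within {0..1})"
      unfolding F_def Q_def using Qpos[OF s] \<open>\<delta> > 0\<close>
      by (auto intro!: derivative_eq_intros simp: Q_def power2_eq_square divide_simps)
    moreover have "(\<beta> * (\<delta> * sqrt (Q s)) - (\<alpha> + \<beta> * s) * (\<delta> * ((2 * \<beta> + 2 * \<gamma> * s) / (2 * sqrt (Q s)))))
         / (\<delta> * sqrt (Q s))\<^sup>2 = (\<beta> * Q s - (\<alpha> + \<beta> * s) * (\<beta> + \<gamma> * s)) / (\<delta> * (Q s * sqrt (Q s)))"
      using sq \<open>\<delta> > 0\<close> Qpos[OF s]
      by (simp add: divide_simps power2_eq_square) (simp add: algebra_simps)
    moreover have "\<beta> * Q s - (\<alpha> + \<beta> * s) * (\<beta> + \<gamma> * s) = \<delta> * s"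
      by (simp add: Q_def \<delta>_def power2_eq_square algebra_simps)
    ultimately show ?thesis
      using \<open>\<delta> > 0\<close> by (simp add: dens[OF s] q3 has_real_derivative_iff_has_vector_derivative)
  qed
  have "integral {0..1} (\<lambda>s. s * harea_density (A + s *\<^sub>R (Y - A))) = F 1 - F 0"
    by (intro integral_unique fundamental_theorem_of_calculus deriv) auto
  also have "\<dots> = 1 / (sqrt (lorentz Y Y) * (sqrt (lorentz A A) * sqrt (lorentz Y Y) + lorentz A Y))"
  proof -
    define a y l where "a = sqrt (lorentz A A)" and "y = sqrt (lorentz Y Y)" and "l = lorentz A Y"
    have p: "a > 0" "y > 0" "l > 0" using A Y by (auto simp: a_def y_def l_def hplane_iff lorentz_pos)
    have \<alpha>a: "\<alpha> = a * a" using A by (simp add: a_def \<alpha>_def hplane_iff)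
    have "F 1 = l / (\<delta> * y)"
      by (simp add: F_def Q_def \<alpha>_def \<beta>_def \<gamma>_def l_def y_def)
    moreover have "F 0 = a / \<delta>"
      using p by (simp add: F_def Q_def \<alpha>a real_sqrt_mult)
    \<comment> \<open>Factoring \<delta> as a difference of squares cancels \<open>l - a * y\<close>
      and leaves a denominator that is a product of positive terms.\<close>
    moreover have d: "\<delta> = (l - a * y) * (l + a * y)"
      using A Y by (simp add: \<delta> a_def y_def l_def hplane_iff algebra_simps power2_eq_square)
    moreover have "l / (\<delta> * y) - a / \<delta> = (l - a * y) / (\<delta> * y)"
      using \<open>\<delta> > 0\<close> p by (simp add: divide_simps)
    moreover have "l - a * y \<noteq> 0" "l + a * y > 0" using d \<open>\<delta> > 0\<close> p by (auto intro: add_pos_pos)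
    ultimately have "F 1 - F 0 = 1 / (y * (a * y + l))"
      by (simp add: add.commute mult.commute)
    then show ?thesis by (simp add: a_def y_def l_def)
  qed
  finally show ?thesis .
qed

text \<open>The vector-valued change of variables is applied to \<open>real^1\<close>, which is
  identified with the scalars by \<open>vec\<close>.\<close>

lemma integral_change_of_variables_scalar:
  fixes f :: "real^'m::{finite,wellorder} \<Rightarrow> real" and g :: "real^'m::_ \<Rightarrow> real^'m::_"
  assumes "S \<in> sets lebesgue"
    and "\<And>x. x \<in> S \<Longrightarrow> (g has_derivative g' x) (at x within S)"
    and "inj_on g S"
    and f: "f absolutely_integrable_on g ` S"
  shows "integral (g ` S) f = integral S (\<lambda>x. \<bar>det (matrix (g' x))\<bar> * f (g x))"
proof -
  have "(\<lambda>x. \<bar>det (matrix (g' x))\<bar> *\<^sub>R (vec (f (g x)) :: real^1)) absolutely_integrable_on S \<and>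
      integral S (\<lambda>x. \<bar>det (matrix (g' x))\<bar> *\<^sub>R (vec (f (g x)) :: real^1)) = vec (integral (g ` S) f)"
    using f has_absolute_integral_change_of_variables[OF assms(1-3), of "\<lambda>x. vec (f x) :: real^1"
        "vec (integral (g ` S) f)"]
    by (simp add: absolutely_integrable_on_1_iff integral_on_1_eq)
  then show ?thesis
    by (simp add: integral_on_1_eq vec_eq_iff)
qed

text \<open>\<open>orient A B C\<close> is the determinant of (1, A), (1, B), (1, C). The right side
  is their Gram determinant for the Lorentz form, whose own matrix diag(1, -1, -1) has determinant
  1.\<close>

lemma orient_square:
  "(orient A B C)\<^sup>2 = lorentz A A * lorentz B B * lorentz C C
     + 2 * lorentz A B * lorentz B C * lorentz A C - lorentz A A * (lorentz B C)\<^sup>2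
     - lorentz B B * (lorentz A C)\<^sup>2 - lorentz C C * (lorentz A B)\<^sup>2"
  by (simp add: orient_def lorentz_coords power2_eq_square algebra_simps)

text \<open>\<open>sqrt (lorentz p p)\<close> is the factor by which \<open>(1, p)\<close> must be divided to lie on the hyperboloid, so the
  argument of \<open>arctan\<close> is the classical \<open>D / (1 + cosh a + cosh b + cosh c)\<close> with denominators cleared.\<close>

lemma integral_sector_density:
  assumes A: "A \<in> hplane" and B: "B \<in> hplane" and C: "C \<in> hplane"
  shows "integral {0..1} (\<lambda>t. let Y = B + t *\<^sub>R (C - B) in
      \<bar>orient A B C\<bar> / (sqrt (lorentz Y Y) * (sqrt (lorentz A A) * sqrt (lorentz Y Y) + lorentz A Y)))
    = 2 * arctan (\<bar>orient A B C\<bar> /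
        (sqrt (lorentz A A) * sqrt (lorentz B B) * sqrt (lorentz C C) + sqrt (lorentz A A) * lorentz B C
         + sqrt (lorentz B B) * lorentz A C + sqrt (lorentz C C) * lorentz A B))"
proof -
  define J a b ab ac bc where "J = \<bar>orient A B C\<bar>" and "a = sqrt (lorentz A A)"
    and "b = sqrt (lorentz B B)" and "ab = lorentz A B" and "ac = lorentz A C" and "bc = lorentz B C"
  define Y where "Y = (\<lambda>t. B + t *\<^sub>R (C - B))"
  define BY AY R where "BY = (\<lambda>t. (1 - t) * b\<^sup>2 + t * bc)" and "AY = (\<lambda>t. (1 - t) * ab + t * ac)"
    and "R = (\<lambda>t. (1 - t)\<^sup>2 * b\<^sup>2 + 2 * t * (1 - t) * bc + t\<^sup>2 * lorentz C C)"
  \<comment> \<open>Half the derivative of \<open>R\<close>.\<close>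
  define R' where "R' = (\<lambda>t. - (1 - t) * b\<^sup>2 + (1 - 2 * t) * bc + t * lorentz C C)"
  \<comment> \<open>The denominator of the area formula for the triangle A, B, \<open>Y t\<close>,
    whose determinant is \<open>J * t\<close> up to sign. Thus the antiderivative is the area
    formula itself with a moving third vertex.\<close>
  define E where "E = (\<lambda>t. a * b * sqrt (R t) + a * BY t + b * AY t + sqrt (R t) * ab)"
  define E' where "E' = (\<lambda>t. (a * b + ab) * (R' t / sqrt (R t)) + a * (bc - b\<^sup>2) + b * (ac - ab))"
  have sq: "a\<^sup>2 = lorentz A A" "b\<^sup>2 = lorentz B B"
    using A B by (auto simp: a_def b_def hplane_iff)
  have pos: "a > 0" "b > 0" "ab > 0"
    using A B by (auto simp: a_def b_def ab_def hplane_iff lorentz_pos)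
  have Yhp: "Y t \<in> hplane" if "t \<in> {0..1}" for t
  proof -
    have "(1 - t) *\<^sub>R B + t *\<^sub>R C \<in> hplane"
      using convexD[OF hplane_convex B C] that by auto
    then show ?thesis by (simp add: Y_def algebra_simps)
  qed
  have YY: "lorentz (Y t) (Y t) = R t" "lorentz B (Y t) = BY t" "lorentz A (Y t) = AY t" for t
    unfolding Y_def R_def BY_def AY_def sq
    by (simp_all add: ab_def ac_def bc_def lorentz_coords power2_eq_square algebra_simps)
  have J2: "J\<^sup>2 = a\<^sup>2 * b\<^sup>2 * lorentz C C + 2 * ab * bc * ac - a\<^sup>2 * bc\<^sup>2 - b\<^sup>2 * ac\<^sup>2 - lorentz C C * ab\<^sup>2"
    by (simp add: J_def orient_square sq ab_def bc_def ac_def)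
  have deriv: "((\<lambda>t. 2 * arctan (J * t / E t)) has_vector_derivative
      J / (sqrt (R t) * (a * sqrt (R t) + AY t))) (at t within {0..1})" if t: "t \<in> {0..1}" for t
  proof -
    have R: "R t > 0" and "BY t > 0" and "AY t > 0"
      using Yhp[OF t] A B by (auto simp flip: YY simp: hplane_iff lorentz_pos)
    define n where "n = sqrt (R t)"
    have n: "n > 0" "n\<^sup>2 = R t" using R by (auto simp: n_def)
    have Epos: "E t > 0"
      using pos n \<open>BY t > 0\<close> \<open>AY t > 0\<close> unfolding E_def n_def[symmetric] by (intro add_pos_pos mult_pos_pos)
    \<comment> \<open>The factor shared by \<open>n * (E t - t * E' t)\<close> and
      \<open>(E t)\<^sup>2 + (J * t)\<^sup>2\<close>. The latter factors because (1 + x + y + z)^2 +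
      D^2 = 2 (1 + x) (1 + y) (1 + z) when x, y, z are the three cosh values.\<close>
    define P where "P = (a * b + ab) * (b * n + BY t)"
    have Ppos: "P > 0" "a * n + AY t > 0" using pos n \<open>BY t > 0\<close> \<open>AY t > 0\<close>
      by (auto simp: P_def intro!: mult_pos_pos add_pos_pos)
    have "t * R' t = R t - BY t"
      by (simp add: R'_def R_def BY_def power2_eq_square algebra_simps)
    then have tn: "t * (R' t / n) = n - BY t / n"
      using n by (simp add: field_simps power2_eq_square)
    have "n * (E t - t * E' t) = n * (E t - ((a * b + ab) * (t * (R' t / n)) + t * a * (bc - b\<^sup>2) + t * b * (ac - ab)))"
      by (simp add: E'_def n_def algebra_simps)
    also have "\<dots> = P"
      unfolding tn using n(1)
      by (simp add: E_def P_def n_def[symmetric] BY_def AY_def field_simps power2_eq_square)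
    finally have EE: "n * (E t - t * E' t) = P" .
    have "(E t)\<^sup>2 + (J * t)\<^sup>2 = 2 * P * (a * n + AY t)"
    proof -
      have "(J * t)\<^sup>2 = a\<^sup>2 * b\<^sup>2 * n\<^sup>2 + 2 * ab * BY t * AY t - a\<^sup>2 * (BY t)\<^sup>2 - b\<^sup>2 * (AY t)\<^sup>2 - n\<^sup>2 * ab\<^sup>2"
        unfolding power_mult_distrib J2 n(2)
        by (simp add: BY_def AY_def R_def power2_eq_square algebra_simps)
      then show ?thesis
        by (simp add: E_def P_def n_def[symmetric] power2_eq_square algebra_simps)
    qed
    note sum_sq = this
    have "(E has_real_derivative E' t) (at t within {0..1})"
      unfolding E_def R_def BY_def AY_def using R
      by (auto intro!: derivative_eq_intros simp: R_def E'_def R'_def)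
         (simp add: field_simps)
    then have "((\<lambda>t. 2 * arctan (J * t / E t)) has_real_derivative
        2 * ((J * E t - J * t * E' t) / (E t)\<^sup>2 / (1 + (J * t / E t)\<^sup>2))) (at t within {0..1})"
      using Epos
      by (auto intro!: derivative_eq_intros simp: power2_eq_square divide_inverse algebra_simps)
    moreover have "2 * ((J * E t - J * t * E' t) / (E t)\<^sup>2 / (1 + (J * t / E t)\<^sup>2))
        = 2 * J * (E t - t * E' t) / ((E t)\<^sup>2 + (J * t)\<^sup>2)"
    proof -
      have "1 + (J * t / E t)\<^sup>2 = ((E t)\<^sup>2 + (J * t)\<^sup>2) / (E t)\<^sup>2"
        using Epos by (simp add: power_divide add_divide_distrib)
      moreover have "2 * (X / q / (r / q)) = 2 * X / r" if "q \<noteq> 0" for X q r :: real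
        using that by simp
      moreover have "2 * (J * E t - J * t * E' t) = 2 * J * (E t - t * E' t)"
        by (simp add: algebra_simps)
      ultimately show ?thesis using Epos by simp
    qed
    moreover have "\<dots> = J / (n * (a * n + AY t))"
    proof -
      have "2 * J * (E t - t * E' t) * (n * (a * n + AY t)) = J * (2 * P * (a * n + AY t))"
        by (simp flip: EE)
      then show ?thesis
        using Ppos n(1) unfolding sum_sq by (simp add: frac_eq_eq)
    qed
    ultimately show ?thesis
      by (simp add: n_def has_real_derivative_iff_has_vector_derivative)
  qed
  have "integral {0..1} (\<lambda>t. J / (sqrt (R t) * (a * sqrt (R t) + AY t)))
      = 2 * arctan (J * 1 / E 1) - 2 * arctan (J * 0 / E 0)"
    by (intro integral_unique fundamental_theorem_of_calculus deriv) auto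
  also have "\<dots> = 2 * arctan (J / (a * b * sqrt (lorentz C C) + a * bc + b * ac + sqrt (lorentz C C) * ab))"
    by (simp add: E_def R_def BY_def AY_def)
  finally show ?thesis
    by (simp add: Let_def flip: YY J_def a_def b_def ab_def ac_def bc_def)
       (simp add: Y_def YY)
qed

section \<open>The triangle in polar coordinates about a vertex\<close>

lemma continuous_on_harea_density: "continuous_on hplane harea_density"
proof -
  have "continuous_on hplane (\<lambda>p. 1 / sqrt ((1 - p \<bullet> p) ^ 3))"
    using hplane_iff by (intro continuous_intros) (auto simp: lorentz_def)
  then show ?thesis
    using harea_density_eq by (simp cong: continuous_on_cong)
qed

text \<open>A continuous density on a compact set is integrable; this leads from the integral over
  \<open>lborel\<close> to the gauge integral, for which the change of variables and the fundamental
  theorem are used.\<close>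

lemma harea_eq_integral:
  assumes "compact S" "S \<subseteq> hplane"
  shows "harea S = integral S harea_density" "harea_density absolutely_integrable_on S"
proof -
  have "set_integrable lborel S harea_density"
    unfolding set_integrable_def using assms continuous_on_subset[OF continuous_on_harea_density]
    by (intro borel_integrable_compact) auto
  then show "harea S = integral S harea_density" "harea_density absolutely_integrable_on S"
    by (simp_all add: harea_def set_borel_integral_eq_integral absolutely_integrable_on_def
        set_integrable_def integrable_completion)
qed

lemma htriangle_hplane:
  assumes "A \<in> hplane" "B \<in> hplane" "C \<in> hplane"
  shows "htriangle A B C \<subseteq> hplane"
  unfolding htriangle_def using assms by (intro hull_minimal hplane_convex) auto

lemma compact_htriangle: "compact (htriangle A B C)"
  by (simp add: htriangle_def finite_imp_compact_convex_hull)

text \<open>Needed to see that a bisecting point is not an end of its side.\<close>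

lemma harea_degenerate:
  assumes "A \<in> hplane" "B \<in> hplane"
  shows "harea (htriangle A B B) = 0"
proof -
  have "htriangle A B B = closed_segment A B"
    by (simp add: htriangle_def segment_convex_hull)
  moreover have "negligible (closed_segment A B)"
    by (simp add: negligible_convex_interior interior_closed_segment_ge2)
  ultimately show ?thesis
    using harea_eq_integral(1)[OF compact_htriangle htriangle_hplane[OF assms assms(2)]]
    by (simp add: integral_negligible)
qed

lemma orient_Cramer:
  fixes A B C :: "real^2"
  assumes "orient A B C \<noteq> 0" "x *\<^sub>R (B - A) + y *\<^sub>R (C - B) = x' *\<^sub>R (B - A) + y' *\<^sub>R (C - B)"
  shows "x = x' \<and> y = y'"
proof -
  define a b c d where "a = (B - A) $ 1" and "b = (B - A) $ 2" and "c = (C - B) $ 1" and "d = (C - B) $ 2"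
  have e: "(x - x') * a + (y - y') * c = 0" "(x - x') * b + (y - y') * d = 0"
    using assms(2) by (simp_all add: vec_eq_iff forall_2 a_def b_def c_def d_def algebra_simps)
  have o: "orient A B C = a * d - b * c"
    by (simp add: orient_def a_def b_def c_def d_def algebra_simps)
  have "(x - x') * (a * d - b * c) = 0" "(y - y') * (a * d - b * c) = 0"
    using e by algebra+
  then show ?thesis using assms(1) o by simp
qed

text \<open>The first coordinate is the fraction of the way from A to the opposite side, the second
  the position on that side. A is removed on both sides because it has no determined second
  coordinate.\<close>

lemma polar_image_triangle:
  "(\<lambda>x::real^2. A + x $ 1 *\<^sub>R ((B - A) + x $ 2 *\<^sub>R (C - B))) ` {x. 0 < x $ 1 \<and> x $ 1 \<le> 1 \<and> 0 \<le> x $ 2 \<and> x $ 2 \<le> 1}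
     - {A} = htriangle A B C - {A}" (is "?g ` ?S - _ = _")
proof -
  have "?g x \<in> htriangle A B C" if "x \<in> ?S" for x
  proof -
    have "?g x = A + (x $ 1 * (1 - x $ 2)) *\<^sub>R (B - A) + (x $ 1 * x $ 2) *\<^sub>R (C - A)"
      by (simp add: algebra_simps)
    moreover have "x $ 1 * (1 - x $ 2) + x $ 1 * x $ 2 \<le> 1"
      using that by (simp add: algebra_simps)
    ultimately show ?thesis
      using that unfolding htriangle_def convex_hull_3_alt
      by (intro CollectI exI[of _ "x $ 1 * (1 - x $ 2)"] exI[of _ "x $ 1 * x $ 2"]) simp
  qed
  moreover have "p \<in> ?g ` ?S" if p: "p \<in> htriangle A B C" "p \<noteq> A" for p
  proof -
    obtain u v where uv: "p = A + u *\<^sub>R (B - A) + v *\<^sub>R (C - A)" "0 \<le> u" "0 \<le> v" "u + v \<le> 1"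
      using p(1) by (auto simp: htriangle_def convex_hull_3_alt)
    then have "u + v > 0" using p(2) by (cases "u = 0 \<and> v = 0") auto
    \<comment> \<open>The weights u and v of B and C add up to the radial coordinate, and v / (u +
      v) is the position on BC.\<close>
    show ?thesis
    proof (rule image_eqI[of _ _ "vector [u + v, v / (u + v)]"])
      have "(u + v) *\<^sub>R (v / (u + v)) *\<^sub>R (C - B) = v *\<^sub>R (C - B)" using \<open>u + v > 0\<close> by simp
      then show "p = ?g (vector [u + v, v / (u + v)])"
        unfolding vector_2 uv(1) scaleR_add_right[of "u + v"] by (simp add: algebra_simps)
      show "vector [u + v, v / (u + v)] \<in> ?S"
        using uv \<open>u + v > 0\<close> by simp
    qed
  qed
  ultimately show ?thesis by blast
qed

text \<open>Polar coordinates about A have Jacobian \<open>x $ 1 * orient A B C\<close>; the two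
  integrations are the radial and the sector integral above.\<close>

theorem harea_htriangle:
  assumes A: "A \<in> hplane" and B: "B \<in> hplane" and C: "C \<in> hplane" and ne: "orient A B C \<noteq> 0"
  shows "harea (htriangle A B C) = 2 * arctan (\<bar>orient A B C\<bar> /
        (sqrt (lorentz A A) * sqrt (lorentz B B) * sqrt (lorentz C C) + sqrt (lorentz A A) * lorentz B C
         + sqrt (lorentz B B) * lorentz A C + sqrt (lorentz C C) * lorentz A B))"
proof -
  define J where "J = \<bar>orient A B C\<bar>"
  define g where "g = (\<lambda>x::real^2. A + x $ 1 *\<^sub>R ((B - A) + x $ 2 *\<^sub>R (C - B)))"
  define g' where "g' = (\<lambda>(x::real^2) (h::real^2). h $ 1 *\<^sub>R ((B - A) + x $ 2 *\<^sub>R (C - B)) + (x $ 1 * h $ 2) *\<^sub>R (C - B))"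
  \<comment> \<open>The edge \<open>x $ 1 = 0\<close> is left out since \<open>g\<close> maps all of
    it to A and is not injective there. It is a null set and is put back before Fubini.\<close>
  define S where "S = {x::real^2. 0 < x $ 1 \<and> x $ 1 \<le> 1 \<and> 0 \<le> x $ 2 \<and> x $ 2 \<le> 1}"
  define Y where "Y = (\<lambda>t. B + t *\<^sub>R (C - B))"
  define F where "F = (\<lambda>x. \<bar>x $ 1 * orient A B C\<bar> * harea_density (g x))"
  note ta = htriangle_hplane[OF A B C] and tc = compact_htriangle[of A B C]
  have gS: "g ` S - {A} = htriangle A B C - {A}"
    unfolding g_def S_def by (rule polar_image_triangle)
  have gsub: "g ` S \<subseteq> htriangle A B C"
  proof
    fix p assume "p \<in> g ` S"
    moreover have "A \<in> htriangle A B C" by (simp add: htriangle_def hull_inc)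
    ultimately show "p \<in> htriangle A B C" using gS by (cases "p = A") blast+
  qed
  have gY: "g (vector [s, t]) = A + s *\<^sub>R (Y t - A)" for s t
    by (simp add: g_def Y_def algebra_simps)
  have inj: "inj_on g S"
  proof (rule inj_onI)
    fix x y assume "x \<in> S" "y \<in> S" "g x = g y"
    then have "x $ 1 *\<^sub>R (B - A) + (x $ 1 * x $ 2) *\<^sub>R (C - B) = y $ 1 *\<^sub>R (B - A) + (y $ 1 * y $ 2) *\<^sub>R (C - B)"
      by (simp add: g_def scaleR_add_right)
    from orient_Cramer[OF ne this] \<open>x \<in> S\<close> show "x = y"
      by (auto simp: S_def vec_eq_iff forall_2)
  qed
  have der: "(g has_derivative g' x) (at x within S)" for x
    unfolding g_def g'_def
    by (auto intro!: derivative_eq_intros bounded_linear_imp_has_derivative[OF bounded_linear_vec_nth]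
          simp: algebra_simps)
  have det: "det (matrix (g' x)) = x $ 1 * orient A B C" for x
    by (simp add: det_2 matrix_def g'_def axis_def orient_def algebra_simps)
  have borel: "S \<in> sets lebesgue"
  proof -
    have "S = {x. 0 < x $ 1} \<inter> {x. x $ 1 \<le> 1} \<inter> {x. 0 \<le> x $ 2} \<inter> {x. x $ 2 \<le> 1}"
      by (auto simp: S_def)
    moreover have "open {x::real^2. 0 < x $ 1}" "closed {x::real^2. x $ 1 \<le> 1}"
        "closed {x::real^2. 0 \<le> x $ 2}" "closed {x::real^2. x $ 2 \<le> 1}"
      by (intro open_Collect_less closed_Collect_le continuous_intros)+
    ultimately show ?thesis
      by (metis borel_closed borel_open sets.Int sets_completionI_sets sets_lborel)
  qed
  have neg: "negligible (htriangle A B C - g ` S)"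
  proof (rule negligible_subset[OF negligible_sing[of A]])
    show "htriangle A B C - g ` S \<subseteq> {A}" using gS by blast
  qed
  have "harea_density absolutely_integrable_on (g ` S)"
  proof (rule absolutely_integrable_spike_set[OF harea_eq_integral(2)[OF tc ta]])
    show "negligible {x \<in> htriangle A B C - g ` S. harea_density x \<noteq> 0}"
      by (rule negligible_subset[OF neg]) blast
    have "{x \<in> g ` S - htriangle A B C. harea_density x \<noteq> 0} = {}" using gsub by blast
    then show "negligible {x \<in> g ` S - htriangle A B C. harea_density x \<noteq> 0}"
      by (simp only: negligible_empty)
  qed
  then have "integral (g ` S) harea_density = integral S F"
    using integral_change_of_variables_scalar[OF borel der inj] by (simp add: det F_def)
  moreover have "integral (htriangle A B C) harea_density = integral (g ` S) harea_density"
    by (rule integral_subset_negligible[OF gsub neg, symmetric])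
  moreover have cbox: "cbox 0 1 = {x::real^2. 0 \<le> x $ 1 \<and> x $ 1 \<le> 1 \<and> 0 \<le> x $ 2 \<and> x $ 2 \<le> 1}"
    by (auto simp: mem_box_cart forall_2)
  moreover have "integral S F = integral (cbox 0 1) F"
  proof (rule integral_subset_negligible)
    have n: "negligible {x::real^2. x $ 1 = 0}" by (rule negligible_standard_hyperplane_cart)
    show "negligible (cbox 0 1 - S)"
      by (rule negligible_subset[OF n]) (auto simp: S_def cbox)
  qed (auto simp: S_def cbox)
  ultimately have 1: "harea (htriangle A B C) = integral (cbox 0 1) F"
    using harea_eq_integral(1)[OF tc ta] by simp
  have "g ` cbox 0 1 \<subseteq> htriangle A B C"
  proof clarify
    fix x :: "real^2" assume x: "x \<in> cbox 0 1"
    show "g x \<in> htriangle A B C"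
    proof (cases "x $ 1 = 0")
      case True then show ?thesis by (simp add: g_def htriangle_def hull_inc)
    next
      case False then show ?thesis using gsub x by (auto simp: S_def cbox)
    qed
  qed
  then have gbox: "g ` cbox 0 1 \<subseteq> hplane" using ta by blast
  have "continuous_on (cbox 0 1) F"
    unfolding F_def
    by (intro continuous_intros continuous_on_compose2[OF continuous_on_harea_density _ gbox])
       (auto simp: g_def intro!: continuous_intros)
  then have "integral (cbox 0 1) F = integral {0..1} (\<lambda>t. integral {0..1} (\<lambda>s. F (vector [s, t])))"
    using integral_real2_iterated[of 0 1 F] by simp
  also have "\<dots> = integral {0..1} (\<lambda>t. let Y = B + t *\<^sub>R (C - B) in
      J / (sqrt (lorentz Y Y) * (sqrt (lorentz A A) * sqrt (lorentz Y Y) + lorentz A Y)))"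
  proof (rule integral_cong)
    fix t :: real assume t: "t \<in> {0..1}"
    have "(1 - t) *\<^sub>R B + t *\<^sub>R C \<in> hplane"
      using convexD[OF hplane_convex B C] t by auto
    then have Y: "Y t \<in> hplane" by (simp add: Y_def algebra_simps)
    \<comment> \<open>If A were \<open>Y t\<close>, both orientations would vanish, forcing t = 0
      and t = 1.\<close>
    have "orient A B (Y t) = t * orient A B C" "orient A (Y t) C = (1 - t) * orient A B C"
      by (simp_all add: orient_def Y_def algebra_simps)
    then have "A \<noteq> Y t" using ne by (auto simp: orient_def)
    have "integral {0..1} (\<lambda>s. F (vector [s, t]))
        = integral {0..1} (\<lambda>s. J * (s * harea_density (A + s *\<^sub>R (Y t - A))))"
      by (rule integral_cong) (simp add: F_def gY J_def abs_mult)
    also have "\<dots> = J * integral {0..1} (\<lambda>s. s * harea_density (A + s *\<^sub>R (Y t - A)))"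
      by simp
    finally show "integral {0..1} (\<lambda>s. F (vector [s, t])) = (let Y = B + t *\<^sub>R (C - B) in
      J / (sqrt (lorentz Y Y) * (sqrt (lorentz A A) * sqrt (lorentz Y Y) + lorentz A Y)))"
      unfolding integral_radial_density[OF A Y \<open>A \<noteq> Y t\<close>] by (simp add: Y_def Let_def)
  qed
  finally show ?thesis
    using 1 integral_sector_density[OF A B C] by (simp add: J_def)
qed

subsection \<open>Distances, determinants and angles on the hyperboloid\<close>

text \<open>With \<open>(1, p) / sqrt (lorentz p p)\<close> as the lift of \<open>p\<close> to the hyperboloid, \<open>hcosh\<close> is the Lorentz
  product of two lifts (the cosh of the distance) and \<open>hdet\<close> is the determinant of three lifts.\<close>

definition hcosh :: "real^2 \<Rightarrow> real^2 \<Rightarrow> real" where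
  "hcosh p q = lorentz p q / (sqrt (lorentz p p) * sqrt (lorentz q q))"

definition hdet :: "real^2 \<Rightarrow> real^2 \<Rightarrow> real^2 \<Rightarrow> real" where
  "hdet p q r = orient p q r / (sqrt (lorentz p p) * sqrt (lorentz q q) * sqrt (lorentz r r))"

lemma hcosh_commute: "hcosh p q = hcosh q p"
  by (simp add: hcosh_def lorentz_commute mult.commute)

lemma lorentz_hcosh:
  assumes "p \<in> hplane" "q \<in> hplane"
  shows "lorentz p q = hcosh p q * sqrt (lorentz p p) * sqrt (lorentz q q)"
  using assms by (simp add: hcosh_def hplane_iff)

lemma hcosh_self: "p \<in> hplane \<Longrightarrow> hcosh p p = 1"
  by (simp add: hcosh_def hplane_iff)

lemma hcosh_gt_1:
  assumes "p \<in> hplane" "q \<in> hplane" "p \<noteq> q"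
  shows "hcosh p q > 1"
proof -
  have "lorentz p p * lorentz q q < (lorentz p q)\<^sup>2" "lorentz p q > 0"
    using lorentz_reverse_Cauchy_Schwarz lorentz_pos assms by auto
  then have "sqrt (lorentz p p) * sqrt (lorentz q q) < lorentz p q"
    by (metis real_less_lsqrt real_sqrt_mult less_eq_real_def)
  then show ?thesis using assms by (simp add: hcosh_def hplane_iff)
qed

lemma hcosh_ge_1: "p \<in> hplane \<Longrightarrow> q \<in> hplane \<Longrightarrow> hcosh p q \<ge> 1"
  using hcosh_gt_1[of p q] hcosh_self[of p] by (cases "p = q") auto

lemma hdet_square:
  assumes "p \<in> hplane" "q \<in> hplane" "r \<in> hplane"
  shows "(hdet p q r)\<^sup>2 = 1 + 2 * hcosh p q * hcosh q r * hcosh p r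
    - (hcosh p q)\<^sup>2 - (hcosh q r)\<^sup>2 - (hcosh p r)\<^sup>2"
proof -
  define a b c where "a = sqrt (lorentz p p)" and "b = sqrt (lorentz q q)" and "c = sqrt (lorentz r r)"
  have pos: "a > 0" "b > 0" "c > 0" and sq: "lorentz p p = a\<^sup>2" "lorentz q q = b\<^sup>2" "lorentz r r = c\<^sup>2"
    using assms by (auto simp: a_def b_def c_def hplane_iff)
  show ?thesis
    unfolding hdet_def hcosh_def power_divide power_mult_distrib orient_square
      a_def[symmetric] b_def[symmetric] c_def[symmetric] sq
    using pos by (simp add: field_simps power2_eq_square)
qed

text \<open>Up to a positive scale, \<open>X - Y\<close> represents the component of the lift of X
  that is Lorentz-orthogonal to the lift of Y. Minus the product of two such components is the
  bracket on the right, the numerator of the hyperbolic law of cosines.\<close>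

lemma hmetric_hcosh:
  assumes "X \<in> hplane" "Y \<in> hplane" "Z \<in> hplane"
  shows "hmetric Y (X - Y) (Z - Y) =
    sqrt (lorentz X X) * sqrt (lorentz Z Z) / lorentz Y Y * (hcosh X Y * hcosh Y Z - hcosh X Z)"
proof -
  define a b c where "a = sqrt (lorentz X X)" and "b = sqrt (lorentz Y Y)" and "c = sqrt (lorentz Z Z)"
  have pos: "a > 0" "b > 0" "c > 0" and sq: "lorentz Y Y = b\<^sup>2"
    using assms by (auto simp: a_def b_def c_def hplane_iff)
  have "hmetric Y (X - Y) (Z - Y) * (lorentz Y Y)\<^sup>2 = lorentz X Y * lorentz Y Z - lorentz X Z * lorentz Y Y"
  proof -
    have "(X - Y) \<bullet> (Z - Y) * lorentz Y Y + (Y \<bullet> (X - Y)) * (Y \<bullet> (Z - Y)) =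
        lorentz X Y * lorentz Y Z - lorentz X Z * lorentz Y Y"
      by (simp add: lorentz_coords inner_real2 algebra_simps)
    moreover have "(m / s + n / s\<^sup>2) * s\<^sup>2 = m * s + n" if "s \<noteq> 0" for m n s :: real
      using that by (simp add: field_simps power2_eq_square)
    moreover have "lorentz Y Y \<noteq> 0" using pos sq by simp
    ultimately show ?thesis
      unfolding hmetric_def lorentz_def[symmetric] by simp
  qed
  then have hm: "hmetric Y (X - Y) (Z - Y) = (lorentz X Y * lorentz Y Z - lorentz X Z * b\<^sup>2) / (b\<^sup>2)\<^sup>2"
    using pos by (simp add: sq eq_divide_eq)
  show ?thesis
    using pos unfolding hm hcosh_def sq a_def[symmetric] b_def[symmetric] c_def[symmetric]
    by (simp add: field_simps power2_eq_square)
qed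

lemma hangle_hcosh:
  assumes "X \<in> hplane" "Y \<in> hplane" "Z \<in> hplane"
  shows "hangle X Y Z = arccos ((hcosh X Y * hcosh Y Z - hcosh X Z) /
    (sqrt ((hcosh X Y)\<^sup>2 - 1) * sqrt ((hcosh Y Z)\<^sup>2 - 1)))"
proof -
  define a b c where "a = sqrt (lorentz X X)" and "b = sqrt (lorentz Y Y)" and "c = sqrt (lorentz Z Z)"
  have pos: "a > 0" "b > 0" "c > 0" and sq: "lorentz Y Y = b\<^sup>2"
    using assms by (auto simp: a_def b_def c_def hplane_iff)
  have "sqrt (hmetric Y (X - Y) (X - Y) * hmetric Y (Z - Y) (Z - Y)) =
      sqrt ((a * c / b\<^sup>2)\<^sup>2 * (((hcosh X Y)\<^sup>2 - 1) * ((hcosh Y Z)\<^sup>2 - 1)))"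
    unfolding hmetric_hcosh[OF assms(1,2,1)] hmetric_hcosh[OF assms(3,2,3)] hcosh_self[OF assms(1)]
      hcosh_self[OF assms(3)] hcosh_commute[of Y X] hcosh_commute[of Z Y] sq a_def[symmetric] c_def[symmetric]
    by (simp add: power2_eq_square)
  also have "\<dots> = a * c / b\<^sup>2 * (sqrt ((hcosh X Y)\<^sup>2 - 1) * sqrt ((hcosh Y Z)\<^sup>2 - 1))"
    using pos by (simp add: real_sqrt_mult real_sqrt_divide)
  finally show ?thesis
    unfolding hangle_def hmetric_hcosh[OF assms] sq a_def[symmetric] c_def[symmetric]
    using pos by simp
qed

section \<open>Angles of a triangle in terms of its sides\<close>

text \<open>Here p and q are cosh of the sides at the angle and r of the opposite side. Since (p q -
  r)^2 + d^2 = (p^2 - 1) (q^2 - 1), the quotient lies strictly between -1 and 1, and d yields the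
  sine.\<close>

lemma arccos_law_of_cosines:
  fixes p q r d :: real
  assumes "p > 1" "q > 1" "d > 0" and d: "d\<^sup>2 = 1 + 2 * p * q * r - p\<^sup>2 - q\<^sup>2 - r\<^sup>2"
  defines "\<theta> \<equiv> arccos ((p * q - r) / (sqrt (p\<^sup>2 - 1) * sqrt (q\<^sup>2 - 1)))"
  shows "cos \<theta> = (p * q - r) / (sqrt (p\<^sup>2 - 1) * sqrt (q\<^sup>2 - 1))"
    and "sin \<theta> = d / (sqrt (p\<^sup>2 - 1) * sqrt (q\<^sup>2 - 1))"
    and "0 < \<theta>" and "\<theta> < pi"
proof -
  define s where "s = sqrt (p\<^sup>2 - 1) * sqrt (q\<^sup>2 - 1)"
  have gt: "p\<^sup>2 > 1" "q\<^sup>2 > 1" using assms by (auto simp: one_less_power)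
  then have s: "s > 0" "s\<^sup>2 = (p\<^sup>2 - 1) * (q\<^sup>2 - 1)" by (auto simp: s_def power_mult_distrib)
  have sum: "(p * q - r)\<^sup>2 + d\<^sup>2 = s\<^sup>2"
    unfolding d s by (simp add: power2_eq_square algebra_simps)
  then have "(p * q - r)\<^sup>2 < s\<^sup>2" using \<open>d > 0\<close> by (smt (verit) zero_less_power)
  then have "\<bar>p * q - r\<bar> < s" using s(1) by (metis abs_of_pos power2_less_imp_less abs_le_square_iff linorder_not_less)
  then have bd: "- 1 < (p * q - r) / s" "(p * q - r) / s < 1" using s by (auto simp: field_simps)
  then show cos: "cos \<theta> = (p * q - r) / (sqrt (p\<^sup>2 - 1) * sqrt (q\<^sup>2 - 1))"
    unfolding \<theta>_def s_def[symmetric] by simp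
  have "1 - ((p * q - r) / s)\<^sup>2 = (d / s)\<^sup>2"
    using sum s(1) by (simp add: power_divide field_simps)
  then show "sin \<theta> = d / (sqrt (p\<^sup>2 - 1) * sqrt (q\<^sup>2 - 1))"
    unfolding \<theta>_def s_def[symmetric] using bd s(1) \<open>d > 0\<close> by (simp add: sin_arccos)
  show "0 < \<theta>" "\<theta> < pi"
    using arccos_lt_bounded[OF bd] by (simp_all add: \<theta>_def s_def)
qed

text \<open>Formally this is the area formula for the triangle in which the middle vertex is replaced by its
  antipode on the other sheet of the hyperboloid.\<close>

lemma triangle_angle_difference:
  fixes p q r d :: real
  assumes gt: "p > 1" "q > 1" "r > 1" and "d > 0" and d: "d\<^sup>2 = 1 + 2 * p * q * r - p\<^sup>2 - q\<^sup>2 - r\<^sup>2"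
  shows "arccos ((p * q - r) / (sqrt (p\<^sup>2 - 1) * sqrt (q\<^sup>2 - 1)))
       - arccos ((r * p - q) / (sqrt (r\<^sup>2 - 1) * sqrt (p\<^sup>2 - 1)))
       - arccos ((q * r - p) / (sqrt (q\<^sup>2 - 1) * sqrt (r\<^sup>2 - 1)))
       = 2 * arctan ((1 + r - p - q) / d)"
proof -
  define Y X Z where "Y = arccos ((p * q - r) / (sqrt (p\<^sup>2 - 1) * sqrt (q\<^sup>2 - 1)))"
    and "X = arccos ((r * p - q) / (sqrt (r\<^sup>2 - 1) * sqrt (p\<^sup>2 - 1)))"
    and "Z = arccos ((q * r - p) / (sqrt (q\<^sup>2 - 1) * sqrt (r\<^sup>2 - 1)))"
  define sp sq sr where "sp = sqrt (p\<^sup>2 - 1)" and "sq = sqrt (q\<^sup>2 - 1)" and "sr = sqrt (r\<^sup>2 - 1)"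
  have "p\<^sup>2 > 1" "q\<^sup>2 > 1" "r\<^sup>2 > 1" using gt by (auto simp: one_less_power)
  then have s: "sp > 0" "sq > 0" "sr > 0" "sp\<^sup>2 = p\<^sup>2 - 1" "sq\<^sup>2 = q\<^sup>2 - 1" "sr\<^sup>2 = r\<^sup>2 - 1"
    by (auto simp: sp_def sq_def sr_def)
  have dX: "d\<^sup>2 = 1 + 2 * r * p * q - r\<^sup>2 - p\<^sup>2 - q\<^sup>2" and dZ: "d\<^sup>2 = 1 + 2 * q * r * p - q\<^sup>2 - r\<^sup>2 - p\<^sup>2"
    using d by (auto simp: mult.commute mult.left_commute)
  note Y = arccos_law_of_cosines[OF gt(1,2) \<open>d > 0\<close> d, folded Y_def sp_def sq_def]
  note X = arccos_law_of_cosines[OF gt(3,1) \<open>d > 0\<close> dX, folded X_def sp_def sr_def]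
  note Z = arccos_law_of_cosines[OF gt(2,3) \<open>d > 0\<close> dZ, folded Z_def sr_def sq_def]
  \<comment> \<open>The triangle inequality: \<open>p * q - sp * sq\<close> is cosh of the
    difference of two sides, hence below r. It makes \<open>cos X + cos Z\<close> positive, so X + Z
    < pi, which later confines T to an interval of length 2 pi.\<close>
  have "(sp * sq)\<^sup>2 - (p * q - r)\<^sup>2 = d\<^sup>2"
    unfolding power_mult_distrib s d by (simp add: power2_eq_square algebra_simps)
  then have "(p * q - r)\<^sup>2 < (sp * sq)\<^sup>2"
    using \<open>d > 0\<close> zero_less_power[of d 2] by linarith
  then have "r > p * q - sp * sq"
    using s power2_less_imp_less[of "p * q - r" "sp * sq"] by simp
  then have "r * (p * sq + q * sp) > (p * q - sp * sq) * (p * sq + q * sp)"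
    using s gt by (intro mult_strict_right_mono add_pos_pos mult_pos_pos) auto
  moreover have "(p * q - sp * sq) * (p * sq + q * sp) = q * sq * (p\<^sup>2 - sp\<^sup>2) + p * sp * (q\<^sup>2 - sq\<^sup>2)"
    by (simp add: power2_eq_square algebra_simps)
  ultimately have "r * (p * sq + q * sp) > q * sq + p * sp" using s by simp
  then have "((r * p - q) * sq + (q * r - p) * sp) / (sp * sq * sr) > 0"
    using s by (simp add: algebra_simps)
  moreover have "cos X + cos Z = ((r * p - q) * sq + (q * r - p) * sp) / (sp * sq * sr)"
    unfolding X(1) Z(1) using s(1-3) by (simp add: divide_simps)
  ultimately have "cos (pi - Z) < cos X" by simp
  then have "\<not> pi - Z \<le> X"
    using cos_monotone_0_pi_le[of "pi - Z" X] X(4) Z(4) by linarith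
  then have sum: "X + Z < pi" by linarith
  define T where "T = Y - (X + Z)"
  define k where "k = (1 + r - p - q) / d"
  have cX: "cos X * (sr * sp) = r * p - q" "sin X * (sr * sp) = d"
    and cZ: "cos Z * (sq * sr) = q * r - p" "sin Z * (sq * sr) = d"
    using X Z s by auto
  \<comment> \<open>The denominator contains sr^2 = (r - 1) (r + 1), and the numerator is divisible
    by r - 1; only r + 1 survives.\<close>
  have cXZ: "cos (X + Z) * (sp * sq * (r + 1)) = p * q * (r - 1) - p\<^sup>2 - q\<^sup>2 + r + 1"
  proof -
    have "cos (X + Z) * (sp * sq * sr\<^sup>2) = (cos X * (sr * sp)) * (cos Z * (sq * sr))
        - (sin X * (sr * sp)) * (sin Z * (sq * sr))"
      by (simp add: cos_add power2_eq_square algebra_simps)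
    also have "\<dots> = (r * p - q) * (q * r - p) - d\<^sup>2"
      unfolding cX cZ by (simp add: power2_eq_square)
    also have "\<dots> = (r - 1) * (p * q * (r - 1) - p\<^sup>2 - q\<^sup>2 + r + 1)"
      unfolding d by (simp add: power2_eq_square algebra_simps)
    finally have "(r - 1) * (cos (X + Z) * (sp * sq * (r + 1))) = (r - 1) * (p * q * (r - 1) - p\<^sup>2 - q\<^sup>2 + r + 1)"
      unfolding s by (simp add: power2_eq_square algebra_simps)
    then show ?thesis using gt by simp
  qed
  have sXZ: "sin (X + Z) * (sp * sq * (r + 1)) = d * (p + q)"
  proof -
    have "sin (X + Z) * (sp * sq * sr\<^sup>2) = (sin X * (sr * sp)) * (cos Z * (sq * sr))
        + (cos X * (sr * sp)) * (sin Z * (sq * sr))"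
      by (simp add: sin_add power2_eq_square algebra_simps)
    also have "\<dots> = d * ((r * p - q) + (q * r - p))"
      unfolding cX cZ by (simp add: algebra_simps)
    finally have "(r - 1) * (sin (X + Z) * (sp * sq * (r + 1))) = (r - 1) * (d * (p + q))"
      unfolding s by (simp add: power2_eq_square algebra_simps)
    then show ?thesis using gt by simp
  qed
  \<comment> \<open>The identity (1 + r + p + q)^2 + d^2 = 2 (1 + r) (1 + p) (1 + q) with p and q
    replaced by their negatives.\<close>
  define m where "m = 2 * (1 + r) * (p - 1) * (q - 1)"
  have mk: "d\<^sup>2 * (1 + k\<^sup>2) = m"
  proof -
    have "d\<^sup>2 * (1 + k\<^sup>2) = d\<^sup>2 + (1 + r - p - q)\<^sup>2"
      using \<open>d > 0\<close> by (simp add: k_def field_simps)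
    then show ?thesis unfolding d m_def by (simp add: power2_eq_square algebra_simps)
  qed
  have kd: "k * d = 1 + r - p - q" using \<open>d > 0\<close> by (simp add: k_def)
  define w where "w = (p\<^sup>2 - 1) * (q\<^sup>2 - 1) * (r + 1)"
  have w: "w > 0" "w = sp * sq * (sp * sq * (r + 1))"
  proof -
    show "w > 0" using gt \<open>p\<^sup>2 > 1\<close> \<open>q\<^sup>2 > 1\<close> by (simp add: w_def)
    have "sp * sq * (sp * sq * (r + 1)) = sp\<^sup>2 * sq\<^sup>2 * (r + 1)"
      by (simp add: power2_eq_square)
    then show "w = sp * sq * (sp * sq * (r + 1))" unfolding s(4,5) w_def by (rule sym)
  qed
  have m: "2 * w = (p + 1) * (q + 1) * m"
    by (simp add: m_def w_def power2_eq_square algebra_simps)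
  have cY: "cos Y * (sp * sq) = p * q - r" "sin Y * (sp * sq) = d"
    using Y s by auto
  have "2 * (cos T * w) = 2 * ((cos Y * (sp * sq)) * (cos (X + Z) * (sp * sq * (r + 1)))
      + (sin Y * (sp * sq)) * (sin (X + Z) * (sp * sq * (r + 1))))"
    unfolding T_def cos_diff w by (simp add: algebra_simps)
  also have "\<dots> = 2 * ((p * q - r) * (p * q * (r - 1) - p\<^sup>2 - q\<^sup>2 + r + 1) + d\<^sup>2 * (p + q))"
    unfolding cY cXZ sXZ by (simp add: power2_eq_square)
  also have "\<dots> = (p + 1) * (q + 1) * (d\<^sup>2 - (k * d)\<^sup>2)"
    unfolding kd d by (simp add: power2_eq_square algebra_simps)
  finally have "2 * cos T * w = (p + 1) * (q + 1) * (d\<^sup>2 - (k * d)\<^sup>2)" by simp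
  moreover have "2 * cos T * w = (p + 1) * (q + 1) * (cos T * m)" using m by simp
  ultimately have "cos T * m = d\<^sup>2 - (k * d)\<^sup>2" using gt by simp
  then have "d\<^sup>2 * (cos T * (1 + k\<^sup>2)) = d\<^sup>2 * (1 - k\<^sup>2)"
    unfolding mk[symmetric] by (simp add: power2_eq_square algebra_simps)
  then have "cos T * (1 + k\<^sup>2) = 1 - k\<^sup>2" using \<open>d > 0\<close> by simp
  moreover have k1: "1 + k\<^sup>2 \<noteq> 0" using zero_le_power2[of k] by linarith
  ultimately have cosT: "cos T = (1 - k\<^sup>2) / (1 + k\<^sup>2)" by (simp add: eq_divide_eq)
  have expand: "(a * b - c * e) * (x * (x * y)) = (a * x) * (b * (x * y)) - (c * x) * (e * (x * y))"
    for a b c e x y :: real by (simp add: algebra_simps)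
  have "sin T * w = (sin Y * (sp * sq)) * (cos (X + Z) * (sp * sq * (r + 1)))
      - (cos Y * (sp * sq)) * (sin (X + Z) * (sp * sq * (r + 1)))"
    unfolding T_def sin_diff w(2) by (rule expand)
  also have "\<dots> = d * ((p + 1) * (q + 1) * (k * d))"
    unfolding cY cXZ sXZ kd by (simp add: power2_eq_square algebra_simps)
  finally have "2 * sin T * w = (p + 1) * (q + 1) * (2 * d * (k * d))" by simp
  moreover have "2 * sin T * w = (p + 1) * (q + 1) * (sin T * m)" using m by simp
  ultimately have "sin T * m = 2 * d * (k * d)" using gt by simp
  moreover have "d\<^sup>2 * (sin T * (1 + k\<^sup>2)) = sin T * m" by (simp add: mk[symmetric])
  ultimately have "d\<^sup>2 * (sin T * (1 + k\<^sup>2)) = d\<^sup>2 * (2 * k)" by (simp add: power2_eq_square)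
  then have "sin T * (1 + k\<^sup>2) = 2 * k" using \<open>d > 0\<close> by simp
  then have sinT: "sin T = 2 * k / (1 + k\<^sup>2)" using k1 by (simp add: eq_divide_eq)
  have "(sqrt (1 + k\<^sup>2))\<^sup>2 = 1 + k\<^sup>2" by simp
  then have "cos (2 * arctan k) = cos T" "sin (2 * arctan k) = sin T"
    unfolding cosT sinT cos_double sin_double cos_arctan sin_arctan
    by (simp_all add: power_divide diff_divide_distrib power2_eq_square[of "sqrt _"])
  then have "cos (T - 2 * arctan k) = 1"
    by (simp add: cos_diff sin_cos_squared_add3)
  \<comment> \<open>T and 2 arctan k have the same cosine and sine and both lie strictly between -pi
    and pi, so the multiple of 2 pi is zero.\<close>
  then obtain n :: int where n: "T - 2 * arctan k = of_int n * (2 * pi)"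
    by (auto simp: cos_one_2pi_int)
  have "- pi < T" "T < pi" using X Y Z sum by (auto simp: T_def)
  moreover have "- pi < 2 * arctan k" "2 * arctan k < pi"
    using arctan_bounded[of k] by auto
  ultimately have "\<bar>of_int n * (2 * pi)\<bar> < 2 * pi" unfolding n[symmetric] by linarith
  then have "n = 0" by (simp add: abs_mult)
  then have "Y - X - Z = 2 * arctan k" using n by (simp add: T_def)
  then show ?thesis unfolding Y_def X_def Z_def k_def .
qed

lemma orient_cyclic: "orient B C A = orient A B C"
  by (simp add: orient_def algebra_simps)

lemma orient_swap: "orient A C B = - orient A B C"
  by (simp add: orient_def algebra_simps)

lemma orient_distinct: "orient A B C \<noteq> 0 \<Longrightarrow> A \<noteq> B \<and> B \<noteq> C \<and> A \<noteq> C"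
  by (auto simp: orient_def)

lemma sgn_hdet:
  assumes "p \<in> hplane" "q \<in> hplane" "r \<in> hplane"
  shows "sgn (hdet p q r) = sgn (orient p q r)"
  using assms by (simp add: hdet_def sgn_divide sgn_mult hplane_iff)

lemma hdet_cyclic: "hdet q r p = hdet p q r"
  by (simp add: hdet_def orient_cyclic[of q r p] mult_ac)

lemma hdet_swap: "hdet p r q = - hdet p q r"
  by (simp add: hdet_def orient_swap[of p q r] mult_ac)

text \<open>Reversing the orientation negates all three signed angles, and arctan is odd; hence the
  sign is absorbed by using \<open>hdet\<close> without absolute value.\<close>

lemma pseudoangle_eq_arctan:
  assumes hp: "X \<in> hplane" "Y \<in> hplane" "Z \<in> hplane" and ne: "orient Y X Z \<noteq> 0"
  shows "pseudoangle X Y Z = 2 * arctan ((1 + hcosh X Z - hcosh X Y - hcosh Y Z) / hdet Y X Z)"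
proof -
  define d where "d = \<bar>hdet Y X Z\<bar>"
  have s: "sgn (hdet Y X Z) = sgn (orient Y X Z)" by (rule sgn_hdet[OF hp(2,1,3)])
  have "d > 0" using s ne by (auto simp: d_def sgn_0_0)
  have gt: "hcosh X Y > 1" "hcosh Y Z > 1" "hcosh X Z > 1"
    using orient_distinct[OF ne] hp by (auto intro: hcosh_gt_1)
  have d2: "d\<^sup>2 = 1 + 2 * hcosh X Y * hcosh Y Z * hcosh X Z - (hcosh X Y)\<^sup>2 - (hcosh Y Z)\<^sup>2 - (hcosh X Z)\<^sup>2"
    unfolding d_def power2_abs hdet_square[OF hp(2,1,3)]
    by (simp add: hcosh_commute[of Y X] algebra_simps)
  have "hangle X Y Z - hangle Z X Y - hangle Y Z X
      = 2 * arctan ((1 + hcosh X Z - hcosh X Y - hcosh Y Z) / d)"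
    unfolding hangle_hcosh[OF hp] hangle_hcosh[OF hp(3,1,2)] hangle_hcosh[OF hp(2,3,1)]
      hcosh_commute[of Z X] hcosh_commute[of Z Y] hcosh_commute[of Y X]
    by (rule triangle_angle_difference[OF gt \<open>d > 0\<close> d2])
  moreover have "orient X Z Y = orient Y X Z" "orient Z Y X = orient Y X Z"
    by (simp_all add: orient_def algebra_simps)
  ultimately have "pseudoangle X Y Z = (if orient Y X Z < 0 then -1 else 1) *
      (2 * arctan ((1 + hcosh X Z - hcosh X Y - hcosh Y Z) / d))"
    by (simp add: pseudoangle_def signed_hangle_def)
  moreover have "hdet Y X Z = (if orient Y X Z < 0 then - d else d)"
    using s ne by (auto simp: d_def sgn_if split: if_splits)
  ultimately show ?thesis by (simp add: arctan_minus)
qed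

lemma harea_hcosh:
  assumes hp: "A \<in> hplane" "B \<in> hplane" "C \<in> hplane" and ne: "orient A B C \<noteq> 0"
  shows "harea (htriangle A B C) =
    2 * arctan (\<bar>hdet A B C\<bar> / (1 + hcosh A B + hcosh B C + hcosh A C))"
proof -
  define a b c where "a = sqrt (lorentz A A)" and "b = sqrt (lorentz B B)" and "c = sqrt (lorentz C C)"
  have pos: "a > 0" "b > 0" "c > 0" using hp by (auto simp: a_def b_def c_def hplane_iff)
  have "a * b * c + a * lorentz B C + b * lorentz A C + c * lorentz A B
      = a * b * c * (1 + hcosh A B + hcosh B C + hcosh A C)"
    unfolding lorentz_hcosh[OF hp(1,2)] lorentz_hcosh[OF hp(2,3)] lorentz_hcosh[OF hp(1,3)]
      a_def[symmetric] b_def[symmetric] c_def[symmetric] by (simp add: algebra_simps)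
  moreover have "\<bar>orient A B C\<bar> = a * b * c * \<bar>hdet A B C\<bar>"
    using pos unfolding hdet_def a_def[symmetric] b_def[symmetric] c_def[symmetric]
    by (simp add: abs_mult)
  ultimately show ?thesis
    using pos unfolding harea_htriangle[OF assms] a_def[symmetric] b_def[symmetric] c_def[symmetric]
    by simp
qed

subsection \<open>Coordinates on a side and the circle functional\<close>

text \<open>The coefficient of the lift of \<open>C\<close> when the lift of \<open>X\<close>, a point of the line \<open>BC\<close>, is written as a
  combination of the lifts of \<open>B\<close> and \<open>C\<close>; the coefficient of the lift of \<open>B\<close> is \<open>hbary A C B X\<close>.\<close>

definition hbary :: "real^2 \<Rightarrow> real^2 \<Rightarrow> real^2 \<Rightarrow> real^2 \<Rightarrow> real" where
  "hbary A B C X = hdet A B X / hdet A B C"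

lemma hdet_nonzero:
  assumes "A \<in> hplane" "B \<in> hplane" "C \<in> hplane"
  shows "hdet A B C = 0 \<longleftrightarrow> orient A B C = 0"
  using sgn_hdet[OF assms] by (metis sgn_0_0)

lemma hline_param:
  assumes "X \<in> hline B C"
  obtains t where "X = B + t *\<^sub>R (C - B)" "X \<in> hplane"
proof -
  obtain u v where "X = u *\<^sub>R B + v *\<^sub>R C" "u + v = 1" "X \<in> hplane"
    using assms by (auto simp: hline_def affine_hull_2)
  then have "X = B + v *\<^sub>R (C - B)" by (simp add: algebra_simps flip: scaleR_add_left)
  then show ?thesis using \<open>X \<in> hplane\<close> by (rule that)
qed

lemma hbary_param:
  assumes "A \<in> hplane" "B \<in> hplane" "C \<in> hplane" "orient A B C \<noteq> 0" "X \<in> hplane"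
    and X: "X = B + t *\<^sub>R (C - B)"
  shows "hbary A B C X = t * sqrt (lorentz C C) / sqrt (lorentz X X)"
    and "hbary A C B X = (1 - t) * sqrt (lorentz B B) / sqrt (lorentz X X)"
proof -
  have "orient A B X = t * orient A B C" "orient A C X = (1 - t) * orient A C B"
    by (simp_all add: X orient_def algebra_simps)
  moreover have "orient A C B \<noteq> 0" using assms(4) by (simp add: orient_swap[of A C B])
  moreover have "lorentz A A > 0" "lorentz B B > 0" "lorentz C C > 0" "lorentz X X > 0"
    using assms by (auto simp: hplane_iff)
  ultimately show "hbary A B C X = t * sqrt (lorentz C C) / sqrt (lorentz X X)"
    and "hbary A C B X = (1 - t) * sqrt (lorentz B B) / sqrt (lorentz X X)"
    using assms(4) by (simp_all add: hbary_def hdet_def)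
qed

lemma hbary_hdet:
  assumes "A \<in> hplane" "B \<in> hplane" "C \<in> hplane" "orient A B C \<noteq> 0"
  shows "hdet A B X = hbary A B C X * hdet A B C" "hdet A X C = hbary A C B X * hdet A B C"
  using hdet_nonzero[OF assms(1-3)] assms(4)
  by (simp_all add: hbary_def hdet_swap[of A B C] hdet_swap[of A X C])

lemma hcosh_hbary:
  assumes "A \<in> hplane" "B \<in> hplane" "C \<in> hplane" "orient A B C \<noteq> 0" "X \<in> hline B C" "P \<in> hplane"
  shows "hcosh P X = hbary A C B X * hcosh P B + hbary A B C X * hcosh P C"
proof -
  obtain t where t: "X = B + t *\<^sub>R (C - B)" "X \<in> hplane" using assms(5) by (rule hline_param)
  have l: "lorentz P X = (1 - t) * lorentz P B + t * lorentz P C"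
    by (simp add: t(1) lorentz_affine)
  have "lorentz P P > 0" "lorentz B B > 0" "lorentz C C > 0" "lorentz X X > 0"
    using assms t(2) by (auto simp: hplane_iff)
  then show ?thesis
    unfolding hbary_param[OF assms(1-4) t(2,1)] hcosh_def l by (simp add: field_simps)
qed

text \<open>The lift of X has Lorentz norm 1.\<close>

lemma hbary_norm:
  assumes "A \<in> hplane" "B \<in> hplane" "C \<in> hplane" "orient A B C \<noteq> 0" "X \<in> hline B C"
  shows "(hbary A C B X)\<^sup>2 + (hbary A B C X)\<^sup>2 + 2 * hbary A C B X * hbary A B C X * hcosh B C = 1"
proof -
  have "X \<in> hplane" using assms(5) by (simp add: hline_def)
  note h = hcosh_hbary[OF assms]
  have "hcosh X X = 1" "hcosh X B = hbary A C B X + hbary A B C X * hcosh B C"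
    "hcosh X C = hbary A C B X * hcosh B C + hbary A B C X"
    using h[OF assms(2)] h[OF assms(3)] hcosh_self \<open>X \<in> hplane\<close> assms
    by (simp_all add: hcosh_commute[of X B] hcosh_commute[of X C] hcosh_commute[of C B])
  then show ?thesis
    using h[OF \<open>X \<in> hplane\<close>] by (simp add: power2_eq_square algebra_simps)
qed

text \<open>The sum is (cosh BX + cosh CX) / (1 + cosh BC). For points outside the segment it
  replaces the positivity of the single coefficients.\<close>

lemma hbary_sum_pos:
  assumes "A \<in> hplane" "B \<in> hplane" "C \<in> hplane" "orient A B C \<noteq> 0" "X \<in> hline B C"
  shows "hbary A C B X + hbary A B C X > 0"
proof -
  have X: "X \<in> hplane" using assms(5) by (simp add: hline_def)
  note h = hcosh_hbary[OF assms]
  have "hcosh B X \<ge> 1" "hcosh C X \<ge> 1" "hcosh B C \<ge> 1" using hcosh_ge_1 assms X by auto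
  moreover have "hcosh B X + hcosh C X = (hbary A C B X + hbary A B C X) * (1 + hcosh B C)"
    unfolding h[OF assms(2)] h[OF assms(3)] hcosh_self[OF assms(2)] hcosh_self[OF assms(3)]
      hcosh_commute[of C B] by (simp add: algebra_simps)
  ultimately show ?thesis by (smt (verit) mult_nonpos_nonneg)
qed

lemma hbary_eq_0:
  assumes "A \<in> hplane" "B \<in> hplane" "C \<in> hplane" "orient A B C \<noteq> 0" "X \<in> hline B C"
  shows "hbary A C B X = 0 \<longleftrightarrow> X = C" "hbary A B C X = 0 \<longleftrightarrow> X = B"
proof -
  obtain t where t: "X = B + t *\<^sub>R (C - B)" "X \<in> hplane" using assms(5) by (rule hline_param)
  have "lorentz B B > 0" "lorentz C C > 0" "lorentz X X > 0"
    using assms t(2) by (auto simp: hplane_iff)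
  moreover have "B \<noteq> C" using orient_distinct[OF assms(4)] by simp
  moreover have "X = C \<longleftrightarrow> t = 1" "X = B \<longleftrightarrow> t = 0"
  proof -
    have "X - C = (t - 1) *\<^sub>R (C - B)" by (simp add: t(1) algebra_simps)
    then show "X = C \<longleftrightarrow> t = 1" using \<open>B \<noteq> C\<close> by (metis eq_iff_diff_eq_0 scaleR_eq_0_iff)
    show "X = B \<longleftrightarrow> t = 0" using \<open>B \<noteq> C\<close> by (simp add: t(1))
  qed
  ultimately show "hbary A C B X = 0 \<longleftrightarrow> X = C" "hbary A B C X = 0 \<longleftrightarrow> X = B"
    unfolding hbary_param[OF assms(1-4) t(2,1)] by auto
qed

text \<open>A point of the line is determined by the ratio of its coefficients. This gives
  uniqueness of the foot and identifies the intersections with the circle.\<close>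

lemma hbary_inj:
  assumes "A \<in> hplane" "B \<in> hplane" "C \<in> hplane" "orient A B C \<noteq> 0" "X \<in> hline B C" "Y \<in> hline B C"
    and "m \<noteq> 0 \<or> n \<noteq> 0"
    and "hbary A C B X * m = hbary A B C X * n" "hbary A C B Y * m = hbary A B C Y * n"
  shows "X = Y"
proof -
  obtain t where t: "X = B + t *\<^sub>R (C - B)" "X \<in> hplane" using assms(5) by (rule hline_param)
  obtain s where s: "Y = B + s *\<^sub>R (C - B)" "Y \<in> hplane" using assms(6) by (rule hline_param)
  define b c where "b = sqrt (lorentz B B)" and "c = sqrt (lorentz C C)"
  have pos: "b > 0" "c > 0" "sqrt (lorentz X X) > 0" "sqrt (lorentz Y Y) > 0"
    using assms t s by (auto simp: hplane_iff b_def c_def)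
  have 1: "(1 - t) * b * m = t * c * n" "(1 - s) * b * m = s * c * n"
    using assms(8,9) pos unfolding hbary_param[OF assms(1-4) t(2,1)] hbary_param[OF assms(1-4) s(2,1)]
      b_def[symmetric] c_def[symmetric] by (simp_all add: field_simps)
  have "(t - s) * (b * m) = 0" "(t - s) * (c * n) = 0"
    using 1 by algebra+
  then have "t = s" using assms(7) pos by auto
  then show ?thesis by (simp add: t s)
qed

text \<open>The value at \<open>A\<close> of the linear functional that equals 1 at the lifts of the three points
  bisecting the area.\<close>

definition vertex_weight :: "real^2 \<Rightarrow> real^2 \<Rightarrow> real^2 \<Rightarrow> real" where
  "vertex_weight A B C = sqrt ((1 + hcosh C A) * (1 + hcosh A B) / (2 * (1 + hcosh B C)))"

lemma vertex_weight_pos: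
  assumes "A \<in> hplane" "B \<in> hplane" "C \<in> hplane"
  shows "vertex_weight A B C > 0"
  using assms hcosh_ge_1[of A B] hcosh_ge_1[of B C] hcosh_ge_1[of C A]
  by (simp add: vertex_weight_def)

text \<open>In half sides the weight at A is cosh(CA/2) cosh(AB/2) / cosh(BC/2), so the weights at A
  and B multiply to cosh^2(AB/2).\<close>

lemma vertex_weight_mult:
  assumes "A \<in> hplane" "B \<in> hplane" "C \<in> hplane"
  shows "2 * vertex_weight A B C * vertex_weight B C A = 1 + hcosh A B"
proof -
  define a b c where "a = 1 + hcosh B C" and "b = 1 + hcosh C A" and "c = 1 + hcosh A B"
  have pos: "a > 0" "b > 0" "c > 0"
    using assms hcosh_ge_1[of A B] hcosh_ge_1[of B C] hcosh_ge_1[of C A] by (auto simp: a_def b_def c_def)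
  have "vertex_weight A B C * vertex_weight B C A = sqrt ((b * c / (2 * a)) * (c * a / (2 * b)))"
    by (simp add: vertex_weight_def a_def b_def c_def flip: real_sqrt_mult)
  also have "(b * c / (2 * a)) * (c * a / (2 * b)) = (c / 2)\<^sup>2"
    using pos by (simp add: power2_eq_square field_simps)
  also have "sqrt ((c / 2)\<^sup>2) = c / 2" using pos by simp
  finally show ?thesis by (simp add: c_def)
qed

lemma vertex_weight_swap: "vertex_weight A C B = vertex_weight A B C"
  by (simp add: vertex_weight_def hcosh_commute[of B A] hcosh_commute[of A C] hcosh_commute[of C B]
      mult.commute)

text \<open>The second inequality follows from the first by the arithmetic-geometric mean and
  prevents v - 1 and w - 1 from both vanishing. The third expresses nondegeneracy and puts the foot
  inside the disc.\<close>

lemma vertex_weight_strict: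
  assumes hp: "A \<in> hplane" "B \<in> hplane" "C \<in> hplane" and ne: "orient A B C \<noteq> 0"
  defines "v \<equiv> vertex_weight B C A" and "w \<equiv> vertex_weight C A B"
  shows "v * w > 1" and "v + w > 2" and "2 * v * w > v + w"
proof -
  define u where "u = vertex_weight A B C"
  have pos: "u > 0" "v > 0" "w > 0" using hp by (auto simp: u_def v_def w_def vertex_weight_pos)
  have m: "hcosh A B = 2 * u * v - 1" "hcosh B C = 2 * v * w - 1" "hcosh A C = 2 * w * u - 1"
    unfolding u_def v_def w_def using vertex_weight_mult[OF hp] vertex_weight_mult[OF hp(2,3,1)]
      vertex_weight_mult[OF hp(3,1,2)] by (simp_all add: hcosh_commute[of A C])
  show vw: "v * w > 1" using m(2) hcosh_gt_1[OF hp(2,3)] orient_distinct[OF ne] by simp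
  have "(v + w)\<^sup>2 = (v - w)\<^sup>2 + 4 * (v * w)" by (simp add: power2_eq_square algebra_simps)
  then have "(v + w)\<^sup>2 > 4" using vw zero_le_power2[of "v - w"] by linarith
  then have "(v + w)\<^sup>2 > 2\<^sup>2" by simp
  then show "v + w > 2" using power2_less_imp_less[of 2 "v + w"] pos by simp
  \<comment> \<open>S is half of 1 + cosh AB + cosh BC + cosh CA, so the identity (2 S)^2 + D^2 = 2
    (1 + cosh AB) (1 + cosh BC) (1 + cosh CA) becomes the formula for D^2 below.\<close>
  define S where "S = v * w + u * (v + w) - 1"
  have "(hdet A B C)\<^sup>2 = 4 * ((2 * u * v * w)\<^sup>2 - S\<^sup>2)"
    unfolding hdet_square[OF hp] m S_def by (simp add: power2_eq_square algebra_simps)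
  moreover have "(hdet A B C)\<^sup>2 > 0" using hdet_nonzero[OF hp] ne by simp
  ultimately have "S\<^sup>2 < (2 * u * v * w)\<^sup>2" by simp
  then have "S < 2 * u * v * w" using power2_less_imp_less[of S "2 * u * v * w"] pos by simp
  then have "u * (v + w) < u * (2 * v * w)" using vw by (simp add: S_def mult_ac)
  then show "2 * v * w > v + w" using pos by simp
qed

text \<open>The square of the circle functional \<open>\<beta> v + \<gamma> w\<close> minus the norm form splits on each side into
  the conditions for the median foot and for the pseudoaltitude foot.\<close>

lemma circle_form_factorization:
  fixes \<beta> \<gamma> v w a :: real
  assumes "2 * v * w = 1 + a"
  shows "(\<beta> * v + \<gamma> * w)\<^sup>2 - (\<beta>\<^sup>2 + \<gamma>\<^sup>2 + 2 * \<beta> * \<gamma> * a) =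
    (\<beta> * (v - 1) - \<gamma> * (w - 1)) * (\<beta> * (v + 1) - \<gamma> * (w + 1))"
proof -
  have a: "a = 2 * v * w - 1" using assms by simp
  show ?thesis unfolding a by (simp add: power2_eq_square algebra_simps)
qed

section \<open>Solving the area and foot equations on a side\<close>

text \<open>The left side is 1 - (\<beta> - \<gamma>)^2, and the norm condition turns it into 2
  \<beta> \<gamma> (1 + a).\<close>

lemma norm_form_factorization:
  fixes \<beta> \<gamma> v w a :: real
  assumes "2 * v * w = 1 + a" "\<beta>\<^sup>2 + \<gamma>\<^sup>2 + 2 * \<beta> * \<gamma> * a = 1"
  shows "(1 + \<gamma> - \<beta>) * (1 + \<beta> - \<gamma>) = 4 * \<beta> * \<gamma> * v * w"
proof -
  have a: "a = 2 * v * w - 1" using assms by simp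
  show ?thesis using assms(2) unfolding a by (simp add: power2_eq_square algebra_simps)
qed

text \<open>Multiplying by 1 + \<gamma> - \<beta> and inserting the norm factorization gives an
  equation of squares. The negative root would make 1 + \<gamma> - \<beta> and 1 + \<beta> -
  \<gamma> both negative, although they add up to 2.\<close>

lemma median_equations:
  fixes \<beta> \<gamma> v w a :: real
  assumes pos: "v > 0" "w > 0" and a: "2 * v * w = 1 + a" and norm: "\<beta>\<^sup>2 + \<gamma>\<^sup>2 + 2 * \<beta> * \<gamma> * a = 1"
    and sgn: "\<beta> > 0" "\<gamma> > 0" and eq: "w * \<gamma> * (1 + \<gamma> - \<beta>) = v * \<beta> * (1 + \<beta> - \<gamma>)"
  shows "\<beta> * v + \<gamma> * w = 1" "\<beta> * (v + 1) = \<gamma> * (w + 1)"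
proof -
  have "w * \<gamma> * (1 + \<gamma> - \<beta>)\<^sup>2 = v * \<beta> * ((1 + \<gamma> - \<beta>) * (1 + \<beta> - \<gamma>))"
    using eq by (simp add: power2_eq_square mult_ac)
  also have "\<dots> = w * \<gamma> * (2 * \<beta> * v)\<^sup>2"
    unfolding norm_form_factorization[OF a norm] by (simp add: power2_eq_square)
  finally have "(1 + \<gamma> - \<beta>)\<^sup>2 = (2 * \<beta> * v)\<^sup>2" using pos sgn by simp
  then consider "1 + \<gamma> - \<beta> = 2 * \<beta> * v" | "1 + \<gamma> - \<beta> = - (2 * \<beta> * v)"
    by (auto simp: power2_eq_iff)
  then have "1 + \<gamma> - \<beta> = 2 * \<beta> * v \<and> 1 + \<beta> - \<gamma> = 2 * \<gamma> * w"
  proof cases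
    case 1
    then have "w * \<gamma> * (2 * \<beta> * v) = v * \<beta> * (1 + \<beta> - \<gamma>)" using eq by simp
    then have "v * \<beta> * (2 * \<gamma> * w) = v * \<beta> * (1 + \<beta> - \<gamma>)" by (simp add: mult_ac)
    then have "2 * \<gamma> * w = 1 + \<beta> - \<gamma>" using pos sgn by simp
    then show ?thesis using 1 by simp
  next
    case 2
    then have "w * \<gamma> * (- (2 * \<beta> * v)) = v * \<beta> * (1 + \<beta> - \<gamma>)" using eq by simp
    then have "v * \<beta> * (- (2 * \<gamma> * w)) = v * \<beta> * (1 + \<beta> - \<gamma>)" by (simp add: mult_ac)
    moreover have "v * \<beta> \<noteq> 0" using pos sgn by simp
    ultimately have "- (2 * \<gamma> * w) = 1 + \<beta> - \<gamma>" by (metis mult_left_cancel)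
    moreover have "\<gamma> * w > 0" "\<beta> * v > 0" using pos sgn by auto
    ultimately show ?thesis using 2 by linarith
  qed
  then show "\<beta> * v + \<gamma> * w = 1" "\<beta> * (v + 1) = \<gamma> * (w + 1)"
    by (simp_all add: algebra_simps)
qed

text \<open>The same squaring with the two brackets exchanged. The negative root gives \<beta> v +
  \<gamma> w = -1 and \<beta> (v + 1) = \<gamma> (w + 1); as \<beta> + \<gamma> > 0, the second
  makes both coefficients positive, against the first.\<close>

lemma foot_equation:
  fixes \<beta> \<gamma> v w a :: real
  assumes pos: "v > 0" "w > 0" and a: "2 * v * w = 1 + a" and norm: "\<beta>\<^sup>2 + \<gamma>\<^sup>2 + 2 * \<beta> * \<gamma> * a = 1"
    and sum: "\<beta> + \<gamma> > 0" "v + w > 2" "2 * v * w > v + w" and ne: "\<beta> \<noteq> 0" "\<gamma> \<noteq> 0"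
  shows "v * \<beta> * (1 + \<gamma> - \<beta>) = w * \<gamma> * (1 + \<beta> - \<gamma>) \<longleftrightarrow> \<beta> * (v - 1) = \<gamma> * (w - 1)"
proof
  assume eq: "v * \<beta> * (1 + \<gamma> - \<beta>) = w * \<gamma> * (1 + \<beta> - \<gamma>)"
  have "v * \<beta> * (1 + \<gamma> - \<beta>)\<^sup>2 = w * \<gamma> * ((1 + \<gamma> - \<beta>) * (1 + \<beta> - \<gamma>))"
    using eq by (simp add: power2_eq_square mult_ac)
  also have "\<dots> = v * \<beta> * (2 * \<gamma> * w)\<^sup>2"
    unfolding norm_form_factorization[OF a norm] by (simp add: power2_eq_square)
  finally have "(1 + \<gamma> - \<beta>)\<^sup>2 = (2 * \<gamma> * w)\<^sup>2" using pos ne by simp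
  then obtain e :: real where e: "e = 1 \<or> e = -1" "1 + \<gamma> - \<beta> = e * (2 * \<gamma> * w)"
    by (metis power2_eq_iff mult_1 mult_minus1)
  then have "v * \<beta> * (e * (2 * \<gamma> * w)) = w * \<gamma> * (1 + \<beta> - \<gamma>)" using eq by simp
  then have "w * \<gamma> * (e * (2 * \<beta> * v)) = w * \<gamma> * (1 + \<beta> - \<gamma>)" by (simp add: mult_ac)
  moreover have "w * \<gamma> \<noteq> 0" using pos ne by simp
  ultimately have e2: "1 + \<beta> - \<gamma> = e * (2 * \<beta> * v)" by (metis mult_left_cancel)
  show "\<beta> * (v - 1) = \<gamma> * (w - 1)"
  proof (cases "e = 1")
    case True
    then show ?thesis using e(2) e2 by (simp add: algebra_simps)
  next
    case False
    then have e1: "e = -1" using e(1) by simp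
    then have "\<beta> * v + \<gamma> * w = - 1" and d: "\<beta> * (v + 1) = \<gamma> * (w + 1)"
      using e(2) e2 by (simp_all add: algebra_simps)
    have "\<beta> * (v + 1) + \<gamma> * (v + 1) > 0" using sum(1) pos by (simp flip: distrib_right)
    then have "\<gamma> * (v + w + 2) > 0" using d by (simp add: algebra_simps)
    then have "\<gamma> > 0" using pos by (simp add: zero_less_mult_iff)
    then have "\<beta> * (v + 1) > 0" using d pos by simp
    then have "\<beta> > 0" using pos by (simp add: zero_less_mult_iff)
    then show ?thesis using \<open>\<gamma> > 0\<close> \<open>\<beta> * v + \<gamma> * w = - 1\<close> pos mult_pos_pos[of \<beta> v] mult_pos_pos[of \<gamma> w]
      by linarith
  qed
next
  assume eq: "\<beta> * (v - 1) = \<gamma> * (w - 1)"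
  then have "(\<beta> * v + \<gamma> * w)\<^sup>2 = 1"
    using circle_form_factorization[OF a, of \<beta> \<gamma>] norm by simp
  moreover have "\<beta> * v + \<gamma> * w > 0"
  proof -
    \<comment> \<open>Under the foot condition the right side vanishes, so the functional times v +
      w - 2 equals a product of positive factors. This excludes the value -1.\<close>
    have "(\<beta> * v + \<gamma> * w) * (v + w - 2) - (\<beta> + \<gamma>) * (2 * v * w - v - w)
        = (v - w) * (\<beta> * (v - 1) - \<gamma> * (w - 1))"
      by (simp add: algebra_simps)
    moreover have "(\<beta> + \<gamma>) * (2 * v * w - v - w) > 0" using sum by (intro mult_pos_pos) auto
    ultimately have "(\<beta> * v + \<gamma> * w) * (v + w - 2) > 0" using eq by simp
    then show ?thesis using sum(2) by (simp add: zero_less_mult_iff)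
  qed
  ultimately have "\<beta> * v + \<gamma> * w = 1" by (simp add: power2_eq_1_iff)
  then have "1 + \<gamma> - \<beta> = 2 * (\<gamma> * w)" "1 + \<beta> - \<gamma> = 2 * (\<beta> * v)"
    using eq by (simp_all add: algebra_simps)
  then show "v * \<beta> * (1 + \<gamma> - \<beta>) = w * \<gamma> * (1 + \<beta> - \<gamma>)" by simp
qed

subsection \<open>Feet of pseudoaltitudes\<close>

text \<open>pi / 2 - \<theta> is the arctangent of the cotangent of \<theta>. It brings the limit
  values at the ends of the side into the same form as a pseudoangle.\<close>

lemma pi_minus_twice_angle:
  fixes p q r d :: real
  assumes "p > 1" "q > 1" "d > 0" "d\<^sup>2 = 1 + 2 * p * q * r - p\<^sup>2 - q\<^sup>2 - r\<^sup>2"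
  shows "pi - 2 * arccos ((p * q - r) / (sqrt (p\<^sup>2 - 1) * sqrt (q\<^sup>2 - 1))) = 2 * arctan ((p * q - r) / d)"
proof -
  define s where "s = sqrt (p\<^sup>2 - 1) * sqrt (q\<^sup>2 - 1)"
  define \<theta> where "\<theta> = arccos ((p * q - r) / s)"
  have "p\<^sup>2 > 1" "q\<^sup>2 > 1" using assms by (auto simp: one_less_power)
  then have "s > 0" by (simp add: s_def)
  note \<theta> = arccos_law_of_cosines[OF assms, folded s_def, folded \<theta>_def]
  have "tan (pi / 2 - \<theta>) = (p * q - r) / d"
    unfolding tan_def cos_diff sin_diff using \<theta>(1,2) \<open>s > 0\<close> \<open>d > 0\<close> by simp
  then have "arctan ((p * q - r) / d) = pi / 2 - \<theta>"
    using \<theta>(3,4) by (intro arctan_unique) auto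
  then show ?thesis by (simp add: \<theta>_def s_def)
qed

lemma pi_minus_twice_hangle:
  assumes "X \<in> hplane" "Y \<in> hplane" "Z \<in> hplane" "orient X Y Z \<noteq> 0"
  shows "pi - 2 * hangle X Y Z = 2 * arctan ((hcosh X Y * hcosh Y Z - hcosh X Z) / \<bar>hdet X Y Z\<bar>)"
  unfolding hangle_hcosh[OF assms(1-3)]
proof (rule pi_minus_twice_angle)
  show "hcosh X Y > 1" "hcosh Y Z > 1" using hcosh_gt_1 orient_distinct assms by auto
  show "\<bar>hdet X Y Z\<bar> > 0" using hdet_nonzero assms by simp
  show "\<bar>hdet X Y Z\<bar>\<^sup>2 = 1 + 2 * hcosh X Y * hcosh Y Z * hcosh X Z
      - (hcosh X Y)\<^sup>2 - (hcosh Y Z)\<^sup>2 - (hcosh X Z)\<^sup>2"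
    using hdet_square[OF assms(1-3)] by simp
qed

text \<open>Clockwise order makes \<open>e\<close> positive. Both pseudoangles are then 2 arctan of
  fractions with denominators \<gamma> e and \<beta> e, and arctan is injective.\<close>

lemma pseudofoot_cond_iff:
  assumes hp: "A \<in> hplane" "B \<in> hplane" "C \<in> hplane" and o: "orient A B C < 0"
  shows "pseudofoot_cond A B C X \<longleftrightarrow> X \<in> hline B C \<and>
    hbary A C B X * (vertex_weight B C A - 1) = hbary A B C X * (vertex_weight C A B - 1)"
proof (cases "X \<in> hline B C")
  case False
  then show ?thesis by (simp add: pseudofoot_cond_def)
next
  case True
  have ne: "orient A B C \<noteq> 0" using o by simp
  have X: "X \<in> hplane" using True by (simp add: hline_def)
  define u v w where "u = vertex_weight A B C" and "v = vertex_weight B C A" and "w = vertex_weight C A B"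
  define a b c where "a = hcosh B C" and "b = hcosh A C" and "c = hcosh A B"
  define \<beta> \<gamma> where "\<beta> = hbary A C B X" and "\<gamma> = hbary A B C X"
  define e where "e = - hdet A B C"
  have pos: "u > 0" "v > 0" "w > 0" using hp by (auto simp: u_def v_def w_def vertex_weight_pos)
  have m: "c = 2 * u * v - 1" "a = 2 * v * w - 1" "b = 2 * w * u - 1"
    unfolding u_def v_def w_def a_def b_def c_def
    using vertex_weight_mult[OF hp] vertex_weight_mult[OF hp(2,3,1)]
      vertex_weight_mult[OF hp(3,1,2)] by (simp_all add: hcosh_commute[of A C])
  have e: "e > 0" using sgn_hdet[OF hp] o unfolding e_def by (metis neg_0_less_iff_less sgn_less)
  note strict = vertex_weight_strict[OF hp ne, folded v_def w_def]
  have comm: "hcosh C B = a" "hcosh B C = a" "hcosh C A = b" "hcosh A C = b" "hcosh B A = c" "hcosh A B = c"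
    by (simp_all add: a_def b_def c_def hcosh_commute)
  have BC: "B \<noteq> C" using orient_distinct[OF ne] by simp
  have perm: "hdet B A C = e" "hdet C B A = e" "\<bar>hdet A B C\<bar> = e" "\<bar>hdet A C B\<bar> = e"
    using e hdet_swap[of A B C] hdet_cyclic[of B A C] hdet_swap[of C B A] hdet_cyclic[of A B C]
      hdet_cyclic[of C A B] hdet_cyclic[of A C B] by (auto simp: e_def)
  have o': "orient B A C \<noteq> 0" "orient C B A \<noteq> 0" "orient A C B \<noteq> 0"
    using ne by (auto simp: orient_def algebra_simps)
  note eq0 = hbary_eq_0[OF hp ne True, folded \<beta>_def \<gamma>_def]
  note norm = hbary_norm[OF hp ne True, folded \<beta>_def \<gamma>_def a_def]
  note sum = hbary_sum_pos[OF hp ne True, folded \<beta>_def \<gamma>_def]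
  consider "X = B" | "X = C" | "X \<noteq> B" "X \<noteq> C" by blast
  then have "(if X = B then pi - 2 * hangle A B C else pseudoangle B X A) =
     (if X = C then pi - 2 * hangle A C B else pseudoangle A X C) \<longleftrightarrow> \<beta> * (v - 1) = \<gamma> * (w - 1)"
  proof cases
    case 1
    \<comment> \<open>The target equation reduces to v = 1, and the angle condition to (1 + a) (1 +
      c) = 2 (1 + b), which says v^2 = 1.\<close>
    have "\<gamma> = 0" "\<beta> \<noteq> 0" using 1 eq0 BC by auto
    have "(pi - 2 * hangle A B C = pseudoangle A B C) \<longleftrightarrow> c * a - b = 1 + b - c - a"
      unfolding pi_minus_twice_hangle[OF hp ne] pseudoangle_eq_arctan[OF hp o'(1)] perm comm
      using e by (simp add: arctan_eq_iff)
    also have "\<dots> \<longleftrightarrow> w * u * (v * v) = w * u * 1"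
      unfolding m by (auto simp: algebra_simps)
    also have "\<dots> \<longleftrightarrow> v = 1"
      using pos by (auto simp: square_eq_1_iff)
    finally show ?thesis using 1 BC \<open>\<gamma> = 0\<close> \<open>\<beta> \<noteq> 0\<close> by simp
  next
    case 2
    have "\<beta> = 0" "\<gamma> \<noteq> 0" using 2 eq0 BC by auto
    have "(pseudoangle B C A = pi - 2 * hangle A C B) \<longleftrightarrow> 1 + c - a - b = b * a - c"
      unfolding pi_minus_twice_hangle[OF hp(1,3,2) o'(3)] pseudoangle_eq_arctan[OF hp(2,3,1) o'(2)] perm comm
      using e by (simp add: arctan_eq_iff)
    also have "\<dots> \<longleftrightarrow> u * v * (w * w) = u * v * 1"
      unfolding m by (auto simp: algebra_simps)
    also have "\<dots> \<longleftrightarrow> w = 1"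
      using pos by (auto simp: square_eq_1_iff)
    finally show ?thesis using 2 BC \<open>\<beta> = 0\<close> \<open>\<gamma> \<noteq> 0\<close> by auto
  next
    case 3
    then have nz: "\<beta> \<noteq> 0" "\<gamma> \<noteq> 0" using eq0 by auto
    have d: "hdet X B A = \<gamma> * e" "hdet X A C = \<beta> * e"
      using hbary_hdet[OF hp ne, of X, folded \<beta>_def \<gamma>_def] hdet_cyclic[of B X A] hdet_cyclic[of A B X]
        hdet_swap[of X A B] hdet_cyclic[of A C X] hdet_swap[of A X C] hdet_cyclic[of X B A]
        hdet_cyclic[of X A B]
      by (simp_all add: e_def)
    then have oX: "orient X B A \<noteq> 0" "orient X A C \<noteq> 0"
      using hdet_nonzero[OF X hp(2,1)] hdet_nonzero[OF X hp(1,3)] nz e by auto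
    have hX: "hcosh A X = \<beta> * c + \<gamma> * b" "hcosh B X = \<beta> + \<gamma> * a" "hcosh C X = \<beta> * a + \<gamma>"
      using hcosh_hbary[OF hp ne True hp(1)] hcosh_hbary[OF hp ne True hp(2)] hcosh_hbary[OF hp ne True hp(3)]
      by (simp_all add: hcosh_self hp comm \<beta>_def \<gamma>_def)
    have cancel: "x / (\<gamma> * e) = y / (\<beta> * e) \<longleftrightarrow> \<beta> * x = \<gamma> * y" for x y
    proof -
      have "x / (\<gamma> * e) = y / (\<beta> * e) \<longleftrightarrow> e * (\<beta> * x) = e * (\<gamma> * y)"
        using nz e by (simp add: frac_eq_eq mult_ac)
      then show ?thesis using e by simp
    qed
    have "pseudoangle B X A = pseudoangle A X C \<longleftrightarrow>
        (1 + c - hcosh B X - hcosh A X) / (\<gamma> * e) = (1 + b - hcosh A X - hcosh C X) / (\<beta> * e)"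
      unfolding pseudoangle_eq_arctan[OF hp(2) X hp(1) oX(1)] pseudoangle_eq_arctan[OF hp(1) X hp(3) oX(2)]
        d comm hcosh_commute[of X A] hcosh_commute[of X C]
      by (simp add: arctan_eq_iff)
    also have "\<dots> \<longleftrightarrow> \<beta> * (1 + c - hcosh B X - hcosh A X) = \<gamma> * (1 + b - hcosh A X - hcosh C X)"
      by (rule cancel)
    \<comment> \<open>The terms \<beta> \<gamma> a cancel; adding \<beta> \<gamma> to both sides
      completes the factors 1 + c and 1 + b.\<close>
    also have "\<dots> \<longleftrightarrow> (1 + c) * \<beta> * (1 + \<gamma> - \<beta>) = (1 + b) * \<gamma> * (1 + \<beta> - \<gamma>)"
      unfolding hX by (auto simp: algebra_simps)
    also have "\<dots> \<longleftrightarrow> 2 * u * (v * \<beta> * (1 + \<gamma> - \<beta>)) = 2 * u * (w * \<gamma> * (1 + \<beta> - \<gamma>))"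
      unfolding m by (simp add: mult_ac)
    also have "\<dots> \<longleftrightarrow> v * \<beta> * (1 + \<gamma> - \<beta>) = w * \<gamma> * (1 + \<beta> - \<gamma>)"
      using pos by (subst mult_left_cancel) auto
    also have "\<dots> \<longleftrightarrow> \<beta> * (v - 1) = \<gamma> * (w - 1)"
      using m(2) by (intro foot_equation[OF pos(2,3) _ norm sum strict(2,3) nz]) simp
    finally show ?thesis using 3 by simp
  qed
  then show ?thesis using True by (simp add: pseudofoot_cond_def \<beta>_def \<gamma>_def v_def w_def)
qed

lemma pseudofoot_exists:
  assumes hp: "A \<in> hplane" "B \<in> hplane" "C \<in> hplane" and ne: "orient A B C \<noteq> 0"
  obtains X where "X \<in> hline B C"
    "hbary A C B X * (vertex_weight B C A - 1) = hbary A B C X * (vertex_weight C A B - 1)"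
proof -
  define v w where "v = vertex_weight B C A" and "w = vertex_weight C A B"
  define b c where "b = sqrt (lorentz B B)" and "c = sqrt (lorentz C C)"
  define a where "a = hcosh B C"
  have pos: "b > 0" "c > 0" "lorentz B B = b\<^sup>2" "lorentz C C = c\<^sup>2"
    using hp by (auto simp: hplane_iff b_def c_def)
  have a: "a = 2 * v * w - 1" "lorentz B C = a * b * c"
    using vertex_weight_mult[OF hp(2,3,1)] lorentz_hcosh[OF hp(2,3)]
    by (simp_all add: a_def v_def w_def b_def c_def)
  note strict = vertex_weight_strict[OF hp ne, folded v_def w_def]
  \<comment> \<open>The norm form at the coefficients (w - 1, v - 1), which solve the foot equation.
    It is a perfect square, so this vector is timelike.\<close>
  define Q where "Q = (w - 1)\<^sup>2 + (v - 1)\<^sup>2 + 2 * (w - 1) * (v - 1) * a"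
  have "Q = (2 * v * w - v - w)\<^sup>2"
    unfolding Q_def a by (simp add: power2_eq_square algebra_simps)
  then have Q: "Q > 0" using strict(3) by simp
  define T where "T = b * (v - 1) + c * (w - 1)"
  \<comment> \<open>T / (b c) is the time coordinate of that vector; if it vanished, the norm form
    could not be positive.\<close>
  have "T \<noteq> 0"
  proof
    assume "T = 0"
    then have T: "b * (v - 1) = - (c * (w - 1))" by (simp add: T_def)
    have "b\<^sup>2 * c\<^sup>2 * Q = (c * (w - 1))\<^sup>2 * b\<^sup>2 + (b * (v - 1))\<^sup>2 * c\<^sup>2
        + 2 * (c * (w - 1)) * (b * (v - 1)) * lorentz B C"
      by (simp add: Q_def a(2) power2_eq_square algebra_simps)
    also have "\<dots> = (c * (w - 1))\<^sup>2 * (lorentz B B + lorentz C C - 2 * lorentz B C)"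
      unfolding T pos(3,4) by (simp add: power2_eq_square algebra_simps)
    also have "\<dots> = - ((c * (w - 1))\<^sup>2 * ((B $ 1 - C $ 1)\<^sup>2 + (B $ 2 - C $ 2)\<^sup>2))"
      by (simp add: lorentz_coords power2_eq_square algebra_simps)
    also have "\<dots> \<le> 0" by simp
    finally show False using Q pos by (simp add: mult_le_0_iff)
  qed
  define t where "t = b * (v - 1) / T"
  have t: "1 - t = c * (w - 1) / T" using \<open>T \<noteq> 0\<close> by (simp add: t_def T_def field_simps)
  define X where "X = B + t *\<^sub>R (C - B)"
  have "lorentz X X = (1 - t)\<^sup>2 * b\<^sup>2 + t\<^sup>2 * c\<^sup>2 + 2 * (1 - t) * t * (a * b * c)"
    unfolding X_def pos(3,4)[symmetric] a(2)[symmetric]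
    by (simp add: lorentz_coords power2_eq_square algebra_simps)
  also have "\<dots> = (b * c / T)\<^sup>2 * Q"
    unfolding t by (simp add: t_def Q_def divide_inverse power2_eq_square algebra_simps)
  finally have X: "X \<in> hplane" using Q pos \<open>T \<noteq> 0\<close> by (simp add: hplane_iff)
  have "X = (1 - t) *\<^sub>R B + t *\<^sub>R C" by (simp add: X_def algebra_simps)
  then have "X \<in> affine hull {B, C}"
    unfolding affine_hull_2 by (intro CollectI exI[of _ "1 - t"] exI[of _ t]) simp
  moreover have "(1 - t) * b * (v - 1) = t * c * (w - 1)" unfolding t by (simp add: t_def)
  ultimately show ?thesis
    using X unfolding v_def w_def
    by (intro that[of X])
      (simp_all add: hline_def hbary_param[OF hp ne X X_def] b_def c_def)
qed

text \<open>Exchanging B and C exchanges the two sides of the foot equation, so both orientation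
  branches of \<open>pseudofoot\<close> describe the same point.\<close>

lemma pseudofoot_on_line:
  assumes hp: "A \<in> hplane" "B \<in> hplane" "C \<in> hplane" and ne: "orient A B C \<noteq> 0"
  shows "pseudofoot A B C \<in> hline B C \<and>
    hbary A C B (pseudofoot A B C) * (vertex_weight B C A - 1) =
    hbary A B C (pseudofoot A B C) * (vertex_weight C A B - 1)"
proof -
  define P where "P = (\<lambda>X. X \<in> hline B C \<and>
    hbary A C B X * (vertex_weight B C A - 1) = hbary A B C X * (vertex_weight C A B - 1))"
  have pf: "pseudofoot A B C = (THE X. P X)"
  proof (cases "orient A B C < 0")
    case True
    then show ?thesis unfolding pseudofoot_def pseudofoot_cond_iff[OF hp True] P_def by simp
  next
    case False
    then have "orient A C B < 0" using ne by (simp add: orient_swap[of A C B])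
    note iff = pseudofoot_cond_iff[OF hp(1,3,2) this]
    have "hline C B = hline B C" by (simp add: hline_def insert_commute)
    moreover have "vertex_weight C B A = vertex_weight C A B" "vertex_weight B A C = vertex_weight B C A"
      by (rule vertex_weight_swap)+
    ultimately have "pseudofoot_cond A C B X \<longleftrightarrow> P X" for X
      unfolding iff P_def by auto
    then have "pseudofoot_cond A C B = P" by blast
    then show ?thesis using False by (simp add: pseudofoot_def)
  qed
  obtain X where "P X" using pseudofoot_exists[OF hp ne] unfolding P_def by blast
  moreover have "Y = Z" if "P Y" "P Z" for Y Z
    using that vertex_weight_strict(2)[OF hp ne] unfolding P_def
    by (intro hbary_inj[OF hp ne, of Y Z "vertex_weight B C A - 1" "vertex_weight C A B - 1"]) auto
  ultimately have "P (THE X. P X)" by (metis theI)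
  then show ?thesis unfolding pf by (simp add: P_def)
qed

subsection \<open>The circle through the bisecting points\<close>

lemma hcircle_iff:
  assumes "P \<in> hplane" "r > 0"
  shows "X \<in> hcircle P r \<longleftrightarrow> X \<in> hplane \<and> hcosh P X = cosh r"
proof -
  have "hdist P X = arcosh (hcosh P X)"
    by (simp add: hdist_def hcosh_def lorentz_def real_sqrt_mult)
  moreover have "arcosh (hcosh P X) = r \<longleftrightarrow> hcosh P X = cosh r" if "X \<in> hplane"
    using hcosh_ge_1[OF assms(1) that] arcosh_cosh_real[of r] cosh_arcosh_real[of "hcosh P X"] assms(2)
    by (metis less_eq_real_def)
  ultimately show ?thesis by (auto simp: hcircle_def)
qed

lemma bisecting_point:
  assumes hp: "A \<in> hplane" "B \<in> hplane" "C \<in> hplane" and ne: "orient A B C \<noteq> 0"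
    and M: "M \<in> hsegment B C" and area: "harea (htriangle A B M) = harea (htriangle A M C)"
  shows "M \<in> hline B C" and "hbary A C B M > 0" and "hbary A B C M > 0"
    and "hbary A C B M * vertex_weight B C A + hbary A B C M * vertex_weight C A B = 1"
    and "hbary A C B M * (vertex_weight B C A + 1) = hbary A B C M * (vertex_weight C A B + 1)"
proof -
  define u v w where "u = vertex_weight A B C" and "v = vertex_weight B C A" and "w = vertex_weight C A B"
  define a b c where "a = hcosh B C" and "b = hcosh A C" and "c = hcosh A B"
  define \<beta> \<gamma> where "\<beta> = hbary A C B M" and "\<gamma> = hbary A B C M"
  define e where "e = \<bar>hdet A B C\<bar>"
  have pos: "u > 0" "v > 0" "w > 0" using hp by (auto simp: u_def v_def w_def vertex_weight_pos)
  have m: "1 + c = 2 * u * v" "2 * v * w = 1 + a" "1 + b = 2 * w * u"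
    unfolding u_def v_def w_def a_def b_def c_def
    using vertex_weight_mult[OF hp] vertex_weight_mult[OF hp(2,3,1)]
      vertex_weight_mult[OF hp(3,1,2)] by (simp_all add: hcosh_commute[of A C])
  have e: "e > 0" using hdet_nonzero[OF hp] ne by (simp add: e_def)
  obtain t where t: "0 \<le> t" "t \<le> 1" and "M = (1 - t) *\<^sub>R B + t *\<^sub>R C"
    using M unfolding hsegment_def closed_segment_def by blast
  then have Mt: "M = B + t *\<^sub>R (C - B)" by (simp add: algebra_simps)
  have Mhp: "M \<in> hplane"
    using convexD[OF hplane_convex hp(2,3), of "1 - t" t] t \<open>M = (1 - t) *\<^sub>R B + t *\<^sub>R C\<close> by simp
  show line: "M \<in> hline B C"
    unfolding hline_def affine_hull_2 using Mhp \<open>M = (1 - t) *\<^sub>R B + t *\<^sub>R C\<close>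
    by (intro IntI CollectI exI[of _ "1 - t"] exI[of _ t]) auto
  have pos_area: "harea (htriangle A B C) > 0"
    unfolding harea_hcosh[OF hp ne] using e hcosh_ge_1[OF hp(1,2)] hcosh_ge_1[OF hp(2,3)] hcosh_ge_1[OF hp(1,3)]
    by (simp add: e_def)
  \<comment> \<open>At an end of the side one part would have area zero and the other would be the
    whole triangle.\<close>
  have "M \<noteq> B" using area pos_area harea_degenerate[OF hp(1,2)] by auto
  have "M \<noteq> C" using area pos_area harea_degenerate[OF hp(1,3)] by auto
  have nonneg: "\<beta> \<ge> 0" "\<gamma> \<ge> 0"
    using t hp Mhp unfolding \<beta>_def \<gamma>_def hbary_param[OF hp ne Mhp Mt] by (auto simp: hplane_iff)
  then have sgn: "\<beta> > 0" "\<gamma> > 0"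
    using hbary_eq_0[OF hp ne line] \<open>M \<noteq> B\<close> \<open>M \<noteq> C\<close> by (auto simp: \<beta>_def \<gamma>_def)
  then show "hbary A C B M > 0" "hbary A B C M > 0" by (simp_all add: \<beta>_def \<gamma>_def)
  have d: "\<bar>hdet A B M\<bar> = \<gamma> * e" "\<bar>hdet A M C\<bar> = \<beta> * e"
    using hbary_hdet[OF hp ne, of M, folded \<beta>_def \<gamma>_def] sgn by (simp_all add: abs_mult e_def)
  then have oM: "orient A B M \<noteq> 0" "orient A M C \<noteq> 0"
    using hdet_nonzero[OF hp(1,2) Mhp] hdet_nonzero[OF hp(1) Mhp hp(3)] sgn e by auto
  have hM: "hcosh A M = \<beta> * c + \<gamma> * b" "hcosh B M = \<beta> + \<gamma> * a" "hcosh M C = \<beta> * a + \<gamma>"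
    using hcosh_hbary[OF hp ne line hp(1)] hcosh_hbary[OF hp ne line hp(2)] hcosh_hbary[OF hp ne line hp(3)]
    by (simp_all add: hcosh_self hp a_def b_def c_def \<beta>_def \<gamma>_def hcosh_commute[of C B] hcosh_commute[of M C])
  have ge: "hcosh A B \<ge> 1" "hcosh B M \<ge> 1" "hcosh A M \<ge> 1" "hcosh M C \<ge> 1" "hcosh A C \<ge> 1"
    using hcosh_ge_1 hp Mhp by auto
  have "\<gamma> * e / (1 + hcosh A B + hcosh B M + hcosh A M) = \<beta> * e / (1 + hcosh A M + hcosh M C + hcosh A C)"
    using area unfolding harea_hcosh[OF hp(1,2) Mhp oM(1)] harea_hcosh[OF hp(1) Mhp hp(3) oM(2)] d
    by (simp add: arctan_eq_iff)
  then have "\<gamma> * (1 + hcosh A M + hcosh M C + hcosh A C) = \<beta> * (1 + hcosh A B + hcosh B M + hcosh A M)"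
    using ge e by (simp add: frac_eq_eq add_pos_nonneg)
  then have "(1 + b) * \<gamma> * (1 + \<gamma> - \<beta>) = (1 + c) * \<beta> * (1 + \<beta> - \<gamma>)"
    unfolding hM a_def[symmetric] b_def[symmetric] c_def[symmetric] by (simp add: algebra_simps)
  then have "2 * u * (w * \<gamma> * (1 + \<gamma> - \<beta>)) = 2 * u * (v * \<beta> * (1 + \<beta> - \<gamma>))"
    unfolding m by (simp add: mult_ac)
  then have "w * \<gamma> * (1 + \<gamma> - \<beta>) = v * \<beta> * (1 + \<beta> - \<gamma>)"
    using pos by simp
  from median_equations[OF pos(2,3) m(2) hbary_norm[OF hp ne line, folded \<beta>_def \<gamma>_def a_def] sgn this]
  show "hbary A C B M * vertex_weight B C A + hbary A B C M * vertex_weight C A B = 1"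
    and "hbary A C B M * (vertex_weight B C A + 1) = hbary A B C M * (vertex_weight C A B + 1)"
    by (simp_all add: \<beta>_def \<gamma>_def v_def w_def)
qed

text \<open>Each relation forces opposite signs on its two unknowns, which is impossible around a
  cycle of length three unless they vanish.\<close>

lemma alternating_signs_zero:
  fixes x y z :: real
  assumes "b\<^sub>1 > 0" "c\<^sub>1 > 0" "b\<^sub>1 * y + c\<^sub>1 * z = 0" "b\<^sub>2 > 0" "c\<^sub>2 > 0" "b\<^sub>2 * z + c\<^sub>2 * x = 0"
    and "b\<^sub>3 > 0" "c\<^sub>3 > 0" "b\<^sub>3 * x + c\<^sub>3 * y = 0"
  shows "y = 0" "z = 0"
proof -
  have flip: "q < 0" if "b > 0" "c > 0" "b * p + c * q = 0" "p > 0" for b c p q :: real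
    using that by (smt (verit) mult_pos_pos mult_nonneg_nonneg)
  have flip': "q > 0" if "b > 0" "c > 0" "b * p + c * q = 0" "p < 0" for b c p q :: real
    using flip[of b c "- p" "- q"] that by simp
  have "\<not> y > 0" using flip[OF assms(1-3)] flip'[OF assms(4-6)] flip[OF assms(7-9)] by fastforce
  moreover have "\<not> y < 0" using flip'[OF assms(1-3)] flip[OF assms(4-6)] flip'[OF assms(7-9)] by fastforce
  ultimately show "y = 0" by linarith
  then show "z = 0" using assms(2,3) by simp
qed

text \<open>The cosh of the distance from the centre P is linear in the lifts. Once it agrees with k
  times the functional at B and C, it does so on the whole line, and the factorization lists the
  intersections.\<close>

lemma circle_meets_side:
  assumes hp: "A \<in> hplane" "B \<in> hplane" "C \<in> hplane" and ne: "orient A B C \<noteq> 0"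
    and M\<^sub>a: "M\<^sub>a \<in> hsegment B C" "harea (htriangle A B M\<^sub>a) = harea (htriangle A M\<^sub>a C)"
    and M\<^sub>b: "M\<^sub>b \<in> hsegment C A" "harea (htriangle B C M\<^sub>b) = harea (htriangle B M\<^sub>b A)"
    and M\<^sub>c: "M\<^sub>c \<in> hsegment A B" "harea (htriangle C A M\<^sub>c) = harea (htriangle C M\<^sub>c B)"
    and circle: "is_hcircle \<Omega>" "M\<^sub>a \<in> \<Omega>" "M\<^sub>b \<in> \<Omega>" "M\<^sub>c \<in> \<Omega>"
  shows "\<Omega> \<inter> hline B C = {M\<^sub>a, pseudofoot A B C}"
proof -
  define u v w where "u = vertex_weight A B C" and "v = vertex_weight B C A" and "w = vertex_weight C A B"
  obtain P r where P: "P \<in> hplane" "r > 0" and \<Omega>: "\<Omega> = hcircle P r"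
    using circle(1) by (auto simp: is_hcircle_def)
  define k where "k = cosh r"
  have k: "k > 0" by (simp add: k_def)
  have mem: "X \<in> \<Omega> \<longleftrightarrow> X \<in> hplane \<and> hcosh P X = k" for X
    using hcircle_iff[OF P] by (simp add: \<Omega> k_def)
  have ne': "orient B C A \<noteq> 0" "orient C A B \<noteq> 0"
    using ne orient_cyclic[of A B C] orient_cyclic[of B C A] by simp_all
  note Ma = bisecting_point[OF hp ne M\<^sub>a, folded v_def w_def]
  note Mb = bisecting_point[OF hp(2,3,1) ne'(1) M\<^sub>b, folded w_def u_def]
  note Mc = bisecting_point[OF hp(3,1,2) ne'(2) M\<^sub>c, folded u_def v_def]
  \<comment> \<open>\<open>x - k * p\<close> is the discrepancy at a vertex between
    \<open>hcosh P\<close> and k times the functional; at each bisecting point the discrepancies of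
    two vertices cancel with positive coefficients.\<close>
  have zero: "\<beta> * (x - k * p) + \<gamma> * (y - k * q) = 0"
    if "k = \<beta> * x + \<gamma> * y" "\<beta> * p + \<gamma> * q = 1" for \<beta> \<gamma> x y p q
  proof -
    have "\<beta> * (x - k * p) + \<gamma> * (y - k * q) = (\<beta> * x + \<gamma> * y) - k * (\<beta> * p + \<gamma> * q)"
      by (simp add: algebra_simps)
    then show ?thesis using that by simp
  qed
  have za: "hbary A C B M\<^sub>a * (hcosh P B - k * v) + hbary A B C M\<^sub>a * (hcosh P C - k * w) = 0"
    using hcosh_hbary[OF hp ne Ma(1) P(1)] circle(2) by (intro zero Ma(4)) (simp add: mem)
  have zb: "hbary B A C M\<^sub>b * (hcosh P C - k * w) + hbary B C A M\<^sub>b * (hcosh P A - k * u) = 0"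
    using hcosh_hbary[OF hp(2,3,1) ne'(1) Mb(1) P(1)] circle(3) by (intro zero Mb(4)) (simp add: mem)
  have zc: "hbary C B A M\<^sub>c * (hcosh P A - k * u) + hbary C A B M\<^sub>c * (hcosh P B - k * v) = 0"
    using hcosh_hbary[OF hp(3,1,2) ne'(2) Mc(1) P(1)] circle(4) by (intro zero Mc(4)) (simp add: mem)
  have PB: "hcosh P B = k * v" and PC: "hcosh P C = k * w"
    using alternating_signs_zero[OF Ma(2,3) za Mb(2,3) zb Mc(2,3) zc] by simp_all
  note foot = pseudofoot_on_line[OF hp ne, folded v_def w_def]
  have pos: "v > 0" "w > 0" using hp by (auto simp: v_def w_def vertex_weight_pos)
  note strict = vertex_weight_strict[OF hp ne, folded v_def w_def]
  have vw: "2 * v * w = 1 + hcosh B C" using vertex_weight_mult[OF hp(2,3,1)] by (simp add: v_def w_def)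
  have iff: "X \<in> \<Omega> \<longleftrightarrow> X = pseudofoot A B C \<or> X = M\<^sub>a" if X: "X \<in> hline B C" for X
  proof -
    define \<beta> \<gamma> where "\<beta> = hbary A C B X" and "\<gamma> = hbary A B C X"
    have Xhp: "X \<in> hplane" using X by (simp add: hline_def)
    have PX: "hcosh P X = k * (\<beta> * v + \<gamma> * w)"
      using hcosh_hbary[OF hp ne X P(1)] by (simp add: PB PC \<beta>_def \<gamma>_def algebra_simps)
    \<comment> \<open>Positivity allows the functional to be compared with 1 through its
      square.\<close>
    then have "\<beta> * v + \<gamma> * w > 0"
      using hcosh_ge_1[OF P(1) Xhp] k by (smt (verit) mult_nonneg_nonpos)
    moreover have "X \<in> \<Omega> \<longleftrightarrow> \<beta> * v + \<gamma> * w = 1" using PX k Xhp by (simp add: mem)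
    ultimately have "X \<in> \<Omega> \<longleftrightarrow> (\<beta> * v + \<gamma> * w)\<^sup>2 = 1" by (auto simp: power2_eq_1_iff)
    also have "\<dots> \<longleftrightarrow> (\<beta> * (v - 1) - \<gamma> * (w - 1)) * (\<beta> * (v + 1) - \<gamma> * (w + 1)) = 0"
      using circle_form_factorization[OF vw, of \<beta> \<gamma>] hbary_norm[OF hp ne X, folded \<beta>_def \<gamma>_def]
      by auto
    also have "\<dots> \<longleftrightarrow> \<beta> * (v - 1) = \<gamma> * (w - 1) \<or> \<beta> * (v + 1) = \<gamma> * (w + 1)" by simp
    also have "\<beta> * (v - 1) = \<gamma> * (w - 1) \<longleftrightarrow> X = pseudofoot A B C"
      using hbary_inj[OF hp ne X, of "pseudofoot A B C" "v - 1" "w - 1"] foot strict(2)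
      unfolding \<beta>_def \<gamma>_def by auto
    also have "\<beta> * (v + 1) = \<gamma> * (w + 1) \<longleftrightarrow> X = M\<^sub>a"
      using hbary_inj[OF hp ne X Ma(1), of "v + 1" "w + 1"] Ma(5) pos
      unfolding \<beta>_def \<gamma>_def by auto
    finally show ?thesis .
  qed
  show ?thesis using iff foot Ma(1) by auto
qed

section \<open>Passing from noncollinear vertices to all three sides\<close>

lemma orient_noncollinear:
  assumes "\<not> collinear {A, B, C}"
  shows "orient A B C \<noteq> 0"
proof
  assume o: "orient A B C = 0"
  have "A \<noteq> B" using assms by auto
  define d where "d = (B - A) $ 1 * (B - A) $ 1 + (B - A) $ 2 * (B - A) $ 2"
  have "d \<noteq> 0"
    using \<open>A \<noteq> B\<close> by (auto simp: d_def sum_squares_eq_zero_iff vec_eq_iff forall_2)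
  define t where "t = ((C - A) \<bullet> (B - A)) / d"
  have e: "(B - A) $ 1 * (C - A) $ 2 = (B - A) $ 2 * (C - A) $ 1"
    using o by (simp add: orient_def)
  have "d * (C - A) $ 1 = ((C - A) \<bullet> (B - A)) * (B - A) $ 1"
    "d * (C - A) $ 2 = ((C - A) \<bullet> (B - A)) * (B - A) $ 2"
    using e unfolding d_def inner_real2 by algebra+
  then have "d * (C - A) $ i = ((C - A) \<bullet> (B - A)) * (B - A) $ i" for i
    using exhaust_2[of i] by auto
  then have "C - A = t *\<^sub>R (B - A)"
    using \<open>d \<noteq> 0\<close> by (simp add: vec_eq_iff t_def field_simps)
  then have "C = A + t *\<^sub>R (B - A)" by (simp add: algebra_simps)
  then have "collinear {A, B, C}"
    unfolding collinear_alt by (intro exI[of _ A] exI[of _ "B - A"])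
      (auto intro: exI[of _ 0] exI[of _ 1] exI[of _ t])
  then show False using assms by simp
qed

theorem mainTheorem2:
  fixes A B C M\<^sub>a M\<^sub>b M\<^sub>c H\<^sub>a H\<^sub>b H\<^sub>c :: "real^2" and \<Omega> :: "(real^2) set"
  assumes points: "A \<in> hplane" "B \<in> hplane" "C \<in> hplane"
    and nondegenerate: "\<not> collinear {A, B, C}"
    and M\<^sub>a: "M\<^sub>a \<in> hsegment B C"
      "harea (htriangle A B M\<^sub>a) = harea (htriangle A M\<^sub>a C)"
    and M\<^sub>b: "M\<^sub>b \<in> hsegment C A"
      "harea (htriangle B C M\<^sub>b) = harea (htriangle B M\<^sub>b A)"
    and M\<^sub>c: "M\<^sub>c \<in> hsegment A B"
      "harea (htriangle C A M\<^sub>c) = harea (htriangle C M\<^sub>c B)"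
    and circle: "is_hcircle \<Omega>" "M\<^sub>a \<in> \<Omega>" "M\<^sub>b \<in> \<Omega>" "M\<^sub>c \<in> \<Omega>"
    and feet: "H\<^sub>a = pseudofoot A B C" "H\<^sub>b = pseudofoot B C A" "H\<^sub>c = pseudofoot C A B"
  shows "{H\<^sub>a, H\<^sub>b, H\<^sub>c} \<subseteq> \<Omega> \<and>
    second_intersection \<Omega> (hline B C) M\<^sub>a H\<^sub>a \<and>
    second_intersection \<Omega> (hline C A) M\<^sub>b H\<^sub>b \<and>
    second_intersection \<Omega> (hline A B) M\<^sub>c H\<^sub>c"
proof -
  have o: "orient A B C \<noteq> 0" "orient B C A \<noteq> 0" "orient C A B \<noteq> 0"
    using orient_noncollinear[OF nondegenerate] orient_cyclic[of A B C] orient_cyclic[of B C A]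
    by simp_all
  have "\<Omega> \<inter> hline B C = {M\<^sub>a, H\<^sub>a}"
    unfolding feet by (rule circle_meets_side[OF points o(1) M\<^sub>a M\<^sub>b M\<^sub>c circle])
  moreover have "\<Omega> \<inter> hline C A = {M\<^sub>b, H\<^sub>b}"
    unfolding feet
    by (rule circle_meets_side[OF points(2,3,1) o(2) M\<^sub>b M\<^sub>c M\<^sub>a circle(1,3,4,2)])
  moreover have "\<Omega> \<inter> hline A B = {M\<^sub>c, H\<^sub>c}"
    unfolding feet
    by (rule circle_meets_side[OF points(3,1,2) o(3) M\<^sub>c M\<^sub>a M\<^sub>b circle(1,4,2,3)])
  \<comment> \<open>When a foot coincides with the bisecting point, the pair collapses to a
    singleton, which is the tangent case.\<close>
  ultimately show ?thesis unfolding second_intersection_def by auto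
qed

end
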